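(* Let $K:(0,\infty)^2\to[0,\infty)$ be continuous and suppose there are constants $0<c_1\le c_2<\infty$ and real exponents $\gamma,\lambda$ with $|\gamma+2\lambda|<1$ and $\gamma<1$ such that for all $x,y\in(0,\infty)$ $$c_1\left(x^{\gamma+\lambda}y^{-\lambda}+x^{-\lambda}y^{\gamma+\lambda}\right)\le K(x,y)\le c_2\left(x^{\gamma+\lambda}y^{-\lambda}+x^{-\lambda}y^{\gamma+\lambda}\right).$$ Let $T>0$, let $f_0\in\mathcal{M}_+((0,\infty))$ with $xf_0\in\mathcal{M}_{+,b}((0,\infty))$, and let $f\in C([0,T],\mathcal{M}_+((0,\infty)))$ be a weak flux solution with initial data $f_0$ to the coagulation equation with kernel $K$. Then: (1) For almost every $t\in[0,T]$, $$M_1(f_t)=M_1(f_0)+t.\qquad (\mathrm{A})$$ (2) There exists a constant $C$, depending only on $T$, the kernel $K$, the exponents $\gamma,\lambda$ and the initial data $f_0$, such that for almost every $(t,z)\in[0,T]\times(0,\infty)$, $$\int_0^t\frac1z\int_{[z/2,z]}x^{\frac{3+\gamma}{2}}f_s(\mathrm{d}x)\,\mathrm{d}s\le C.\qquad(\mathrm{B})$$ (3) If $f$ moreover satisfies the flux identity $$\int_{(0,z]}x f_t(\mathrm{d}x)-\int_{(0,z]}x f_0(\mathrm{d}x)=-\int_0^tJ_{f_s}(z)\,\mathrm{d}s+t\qquad(\mathrm{E})$$ for all $t\in[0,T]$ (and almost every $z$), then (A) holds for all $t\in[0,T]$; and if (E) holds for all $(t,z)\in[0,T]\times(0,\infty)$,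 then (B) holds for all $(t,z)\in[0,T]\times(0,\infty)$.
   Context: Notation: $\mathbb{R}_*=(0,\infty)$. $\mathcal{M}_+(X)$ is the set of positive Radon measures on $X$ and $\mathcal{M}_{+,b}(X)$ the set of those that are bounded ($\mu(X)<\infty$). For a measure $\mu$ on $\mathbb{R}_*$, $x\mu$ denotes the measure $x\,\mu(\mathrm{d}x)$, and $M_1(\mu)=\int_{\mathbb{R}_*}x\,\mu(\mathrm{d}x)$. Continuity in time of measure-valued maps is with respect to the weak* topology on the target, i.e. $t\mapsto\int\phi\,\mathrm{d}\mu_t$ is continuous for every $\phi\in C_c(\mathbb{R}_* )$. For $z>0$ let $\Omega_z=\{(x,y)\in\mathbb{R}_*^2: 0<x\le z,\ z-x<y\}$ and $J_\mu(z)=\iint_{\Omega_z}xK(x,y)\,\mu(\mathrm{d}x)\mu(\mathrm{d}y)$. Definition (weak flux solution). $f\in C([0,T],\mathcal{M}_+(\mathbb{R}_* ))$ is a weak flux solution with initial data $f_0\in\mathcal{M}_+(\mathbb{R}_* )$, where $xf_0\in\mathcal{M}_{+,b}(\mathbb{R}_* )$, if (i) $xf\in C([0,T],\mathcal{M}_{+,b}(\mathbb{R}_* ))$ (weak* topology on the target); (ii) for almost every $(t,z)\in[0,T]\times\mathbb{R}_*$, $$\int_{(0,z]}x f_t(\mathrm{d}x)-\int_{(0,z]}x f_0(\mathrm{d}x)=-\int_0^tJ_{f_s}(z)\,\mathrm{d}s+t,$$ where the time-integrated flux $\int_0^tJ_{f_s}(z)\,\mathrm{d}s$ is finite for all $t\in[0,T]$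 and almost every $z\in\mathbb{R}_*$. *)

theory Defs
  imports "HOL-Analysis.Analysis"
begin

text \<open>
  Measures on a subset \<open>X\<close> live on the trace Borel sigma-algebra, so their space is \<open>X\<close> itself.
  The subsets of \<open>X\<close> that are compact in \<open>X\<close> are those compact in the ambient type.
\<close>

definition radon_measures :: "'a::topological_space set \<Rightarrow> 'a measure set" where
  "radon_measures X = {\<mu>. sets \<mu> = sets (restrict_space borel X) \<and>
     (\<forall>C. compact C \<and> C \<subseteq> X \<longrightarrow> emeasure \<mu> C < \<infinity>) \<and>
     (\<forall>B\<in>sets \<mu>. emeasure \<mu> B = (SUP C\<in>{C. compact C \<and> C \<subseteq> B}. emeasure \<mu> C))}"

definition bounded_radon_measures :: "'a::topological_space set \<Rightarrow> 'a measure set" where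
  "bounded_radon_measures X = {\<mu> \<in> radon_measures X. emeasure \<mu> (space \<mu>) < \<infinity>}"

definition compactly_supported :: "'a::topological_space set \<Rightarrow> ('a \<Rightarrow> real) set" where
  "compactly_supported X = {\<phi>. continuous_on X \<phi> \<and>
     (\<exists>C. compact C \<and> C \<subseteq> X \<and> (\<forall>x\<in>X - C. \<phi> x = 0))}"

text \<open>The space \<open>C([0,T], S)\<close>, where \<open>S\<close> is a set of measures on \<open>X\<close> with the weak* topology,
  tested against \<open>C_c(X)\<close> also when \<open>S\<close> consists of bounded measures.\<close>

definition weak_star_curves ::
    "real \<Rightarrow> 'a::topological_space set \<Rightarrow> 'a measure set \<Rightarrow> (real \<Rightarrow> 'a measure) set" where
  "weak_star_curves T X S = {F. (\<forall>t\<in>{0..T}. F t \<in> S) \<and>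
     (\<forall>\<phi>\<in>compactly_supported X. continuous_on {0..T} (\<lambda>t. \<integral>x. \<phi> x \<partial>F t))}"

definition x_times :: "real measure \<Rightarrow> real measure" where
  "x_times \<mu> = density \<mu> (\<lambda>x. ennreal x)"

definition M1 :: "real measure \<Rightarrow> ennreal" where
  "M1 \<mu> = (\<integral>\<^sup>+x. ennreal x \<partial>\<mu>)"

definition mass_upto :: "real measure \<Rightarrow> real \<Rightarrow> ennreal" where
  "mass_upto \<mu> z = (\<integral>\<^sup>+x\<in>{0<..z}. ennreal x \<partial>\<mu>)"

definition Omega :: "real \<Rightarrow> (real \<times> real) set" where
  "Omega z = {(x, y). 0 < x \<and> 0 < y \<and> x \<le> z \<and> z - x < y}"

definition flux :: "(real \<Rightarrow> real \<Rightarrow> real) \<Rightarrow> real measure \<Rightarrow> real \<Rightarrow> ennreal" where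
  "flux K \<mu> z = (\<integral>\<^sup>+p\<in>Omega z. (case p of (x, y) \<Rightarrow> ennreal (x * K x y)) \<partial>(\<mu> \<Otimes>\<^sub>M \<mu>))"

definition time_flux ::
    "(real \<Rightarrow> real \<Rightarrow> real) \<Rightarrow> (real \<Rightarrow> real measure) \<Rightarrow> real \<Rightarrow> real \<Rightarrow> ennreal" where
  "time_flux K f t z = (\<integral>\<^sup>+s\<in>{0..t}. flux K (f s) z \<partial>lborel)"

text \<open>
  The identity is stated in the extended reals: when the masses are finite, it fails
  wherever the time-integrated flux is infinite.
\<close>

definition flux_identity ::
    "(real \<Rightarrow> real \<Rightarrow> real) \<Rightarrow> real measure \<Rightarrow> (real \<Rightarrow> real measure) \<Rightarrow> real \<Rightarrow> real \<Rightarrow> bool" where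
  "flux_identity K f0 f t z \<longleftrightarrow>
     enn2ereal (mass_upto (f t) z) - enn2ereal (mass_upto f0 z)
       = - enn2ereal (time_flux K f t z) + ereal t"

definition weak_flux_solution ::
    "(real \<Rightarrow> real \<Rightarrow> real) \<Rightarrow> real \<Rightarrow> real measure \<Rightarrow> (real \<Rightarrow> real measure) \<Rightarrow> bool" where
  "weak_flux_solution K T f0 f \<longleftrightarrow>
     f0 \<in> radon_measures {0<..} \<and> x_times f0 \<in> bounded_radon_measures {0<..} \<and>
     f \<in> weak_star_curves T {0<..} (radon_measures {0<..}) \<and>
     (\<lambda>t. x_times (f t)) \<in> weak_star_curves T {0<..} (bounded_radon_measures {0<..}) \<and>
     (AE (t, z) in lborel. t \<in> {0..T} \<and> z > 0 \<longrightarrow> flux_identity K f0 f t z) \<and>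
     (\<forall>t\<in>{0..T}. AE z in lborel. z > 0 \<longrightarrow> time_flux K f t z < \<infinity>)"

definition kernel_bounds :: "(real \<Rightarrow> real \<Rightarrow> real) \<Rightarrow> real \<Rightarrow> real \<Rightarrow> real \<Rightarrow> real \<Rightarrow> bool" where
  "kernel_bounds K \<gamma> l c1 c2 \<longleftrightarrow> (\<forall>x>0. \<forall>y>0.
     c1 * (x powr (\<gamma> + l) * y powr (- l) + x powr (- l) * y powr (\<gamma> + l)) \<le> K x y \<and>
     K x y \<le> c2 * (x powr (\<gamma> + l) * y powr (- l) + x powr (- l) * y powr (\<gamma> + l)))"

definition averaged_moment :: "real \<Rightarrow> (real \<Rightarrow> real measure) \<Rightarrow> real \<Rightarrow> real \<Rightarrow> ennreal" where
  "averaged_moment \<gamma> f t z =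
     (\<integral>\<^sup>+s\<in>{0..t}. ennreal (1 / z) *
        (\<integral>\<^sup>+x\<in>{z / 2..z}. ennreal (x powr ((3 + \<gamma>) / 2)) \<partial>f s) \<partial>lborel)"

end

theory Submission
  imports Defs "HOL-Probability.Giry_Monad"
begin

text \<open>
  Normalise the mass measures \<open>x f\<^sub>s\<close> to sub-probabilities \<open>N s\<close>, put \<open>a = \<gamma> + l\<close>, \<open>b = - l\<close> and
  \<open>\<delta> = (1 - \<gamma>) / 2\<close>; the exponent conditions say exactly that \<open>a\<close> and \<open>b\<close> lie in \<open>(- \<delta>, 1)\<close> when
  \<open>a + b = \<gamma>\<close>. The balance bounds the time-integrated flux by \<open>M = M\<^sub>1(f\<^sub>0) + T\<close>. Pairs in
  \<open>(z/2, z]\<close> all belong to \<open>Omega z\<close>, so the flux dominates \<open>z powr (\<gamma> - 1)\<close> times the square of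
  the mass of \<open>(z/2, z]\<close>; hence the time-integrated mass of a dyadic block is \<open>O(z powr \<delta>)\<close>,
  which is (B), and summing over blocks controls the moments of order \<open>a\<close> and \<open>b\<close> on \<open>(0, R]\<close>.
  Averaging the flux over \<open>z \<in> [R, 2R]\<close> tames the singularity of \<open>K\<close> at small \<open>y\<close>, and these
  moments bound the average by \<open>O(R powr (- \<delta>))\<close>. So the flux vanishes along a sequence
  \<open>z \<rightarrow> \<infinity>\<close>, which gives (A).
\<close>

section \<open>Flux estimates for kernels of mass measures\<close>

text \<open>The ratio \<open>x / z\<close> lies between 1/2 and 2, so \<open>p * ln (x / z)\<close>
  has modulus at most \<open>\<bar>p\<bar> * ln 2\<close>; the absolute value serves exponents of
  either sign.\<close>

lemma powr_comparable:
  fixes x z p :: real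
  assumes "0 < z" "z / 2 \<le> x" "x \<le> 2 * z"
  shows "2 powr (- \<bar>p\<bar>) * z powr p \<le> x powr p" "x powr p \<le> 2 powr \<bar>p\<bar> * z powr p"
proof -
  have x: "0 < x" using assms by linarith
  have "ln (x / z) \<le> ln 2"
    using x assms by (subst ln_le_cancel_iff) (auto simp: field_simps)
  moreover have "ln (1 / 2) \<le> ln (x / z)"
    using x assms by (subst ln_le_cancel_iff) (auto simp: field_simps)
  ultimately have "\<bar>ln (x / z)\<bar> \<le> ln 2" by (simp add: ln_div)
  then have "\<bar>p * ln (x / z)\<bar> \<le> \<bar>p\<bar> * ln 2"
    unfolding abs_mult by (intro mult_left_mono) auto
  then have u: "2 powr (- \<bar>p\<bar>) \<le> (x / z) powr p" "(x / z) powr p \<le> 2 powr \<bar>p\<bar>"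
    using x assms(1) by (auto simp: powr_def)
  have "x powr p = (x / z) powr p * z powr p"
    using x assms(1) by (simp add: powr_mult[symmetric])
  with u show "2 powr (- \<bar>p\<bar>) * z powr p \<le> x powr p" "x powr p \<le> 2 powr \<bar>p\<bar> * z powr p"
    by (auto intro!: mult_right_mono)
qed

text \<open>An open interval has positive length, so it cannot avoid a set of full measure. Good
  values of z are thus available near any prescribed one.\<close>

lemma AE_positive_obtain:
  fixes u v :: real
  assumes "AE z in lborel. z > 0 \<longrightarrow> Q z" "0 \<le> u" "u < v"
  obtains z where "u < z" "z < v" "Q z"
proof -
  have "\<exists>z\<in>{u<..<v}. Q z"
  proof (rule ccontr)
    assume *: "\<not> (\<exists>z\<in>{u<..<v}. Q z)"
    have "AE z in lborel. z \<notin> {u<..<v}"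
      using assms(1) by eventually_elim (use * assms in auto)
    then have "emeasure lborel {u<..<v} = 0"
      by (subst (asm) AE_iff_measurable[of "{u<..<v}"]) auto
    with assms show False by simp
  qed
  with that show ?thesis by auto
qed

text \<open>\<open>P\<close> stands for Lebesgue measure on a time interval and \<open>W x y\<close>
  for a multiple of K(x,y)/y: in the flux, x K \<mu>(dx) \<mu>(dy) equals (K/y) times the product of
  the mass measures x\<mu>(dx) and y\<mu>(dy). \<open>W_lower\<close> keeps one of the two kernel
  terms.\<close>

locale mass_flux = finite_measure P for P :: "'s measure" +
  fixes N :: "'s \<Rightarrow> real measure" and W :: "real \<Rightarrow> real \<Rightarrow> real" and a b c1 c2 :: real
  assumes N_kernel [measurable]: "N \<in> measurable P (subprob_algebra borel)"
    and W_measurable: "(\<lambda>(x, y). W x y) \<in> borel_measurable borel"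
    and c1_pos: "0 < c1" and c2_pos: "0 < c2"
    and W_lower: "\<And>x y. 0 < x \<Longrightarrow> 0 < y \<Longrightarrow> c1 * (x powr a * y powr (b - 1)) \<le> W x y"
    and W_upper: "\<And>x y. 0 < x \<Longrightarrow> 0 < y \<Longrightarrow>
      W x y \<le> c2 * (x powr a * y powr (b - 1) + x powr b * y powr (a - 1))"
    and exponents: "\<bar>a - b\<bar> < 1" "a + b < 1"
begin

section \<open>The flux at a single time, the decay exponent, and measurability\<close>

definition F :: "'s \<Rightarrow> real \<Rightarrow> ennreal" where
  "F s z = (\<integral>\<^sup>+x. \<integral>\<^sup>+y. ennreal (W x y) * indicator (Omega z) (x, y) \<partial>N s \<partial>N s)"

definition \<delta> :: real where "\<delta> = (1 - (a + b)) / 2"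

text \<open>Here \<open>a + \<delta>\<close> is \<open>(1 + (a - b)) / 2\<close> and
  \<open>b + \<delta>\<close> is \<open>(1 - (a - b)) / 2\<close>, while \<open>2 * a\<close> is
  \<open>(a + b) + (a - b)\<close>, and likewise for \<open>2 * b\<close>.\<close>

lemma \<delta>_pos: "0 < \<delta>" and a_\<delta>: "0 < a + \<delta>" and b_\<delta>: "0 < b + \<delta>" and a_less: "a < 1" and b_less: "b < 1"
  using exponents by (auto simp: \<delta>_def abs_less_iff field_simps)

lemma sets_N: "s \<in> space P \<Longrightarrow> sets (N s) = sets borel"
  using N_kernel by (rule sets_kernel)

lemma subprob_N: "s \<in> space P \<Longrightarrow> subprob_space (N s)"
  using N_kernel by (rule subprob_space_kernel)

lemma W_measurable' [measurable]:
  "(\<lambda>x. W (f x) (g x)) \<in> borel_measurable M" if [measurable]: "f \<in> borel_measurable M" "g \<in> borel_measurable M"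
  using measurable_compose[OF borel_measurable_Pair[OF that] W_measurable] by simp

lemma Omega_pred [measurable]:
  "Measurable.pred M (\<lambda>w. (f w, g w) \<in> Omega (h w))"
  if [measurable]: "f \<in> borel_measurable M" "g \<in> borel_measurable M" "h \<in> borel_measurable M"
  unfolding Omega_def mem_Collect_eq case_prod_conv by measurable

text \<open>Integration against a measurable kernel preserves joint measurability in the remaining
  parameters. It is applied to the inner integral with parameters s, z, x and then to the outer one
  with s, z.\<close>

lemma F_measurable: "(\<lambda>(s, z). F s z) \<in> borel_measurable (P \<Otimes>\<^sub>M borel)"
proof -
  have 1: "(\<lambda>w. N (fst w)) \<in> measurable (P \<Otimes>\<^sub>M borel) (subprob_algebra borel)"
    "(\<lambda>w. N (fst (fst w))) \<in> measurable ((P \<Otimes>\<^sub>M borel) \<Otimes>\<^sub>M borel) (subprob_algebra borel)"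
    by measurable
  \<comment> \<open>The set \<open>Omega z\<close> moves with z; one fixed set in all variables
    makes the indicator visibly measurable.\<close>
  have i: "indicator (Omega (snd (fst w))) (snd w, y) = (indicator {v. (snd (fst v), snd v) \<in> Omega (snd (fst (fst v)))} (w, y) :: ennreal)" for w :: "('s \<times> real) \<times> real" and y
    by (simp split: split_indicator)
  have "(\<lambda>(w, y). ennreal (W (snd w) y) * indicator (Omega (snd (fst w))) (snd w, y))
      \<in> borel_measurable (((P \<Otimes>\<^sub>M borel) \<Otimes>\<^sub>M borel) \<Otimes>\<^sub>M borel)"
    unfolding i by measurable
  from nn_integral_measurable_subprob_algebra2[OF this 1(2)]
  have "(\<lambda>(w, x). \<integral>\<^sup>+y. ennreal (W x y) * indicator (Omega (snd w)) (x, y) \<partial>N (fst w))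
      \<in> borel_measurable ((P \<Otimes>\<^sub>M borel) \<Otimes>\<^sub>M borel)"
    by (simp add: split_beta')
  from nn_integral_measurable_subprob_algebra2[OF this 1(1)]
  show ?thesis by (simp add: split_beta' F_def)
qed

lemma F_measurable1: "(\<lambda>s. F s z) \<in> borel_measurable P"
  using measurable_compose[OF _ F_measurable, of "\<lambda>s. (s, z)" P] by simp

lemma moment_measurable:
  assumes [measurable]: "g \<in> borel_measurable borel"
  shows "(\<lambda>s. \<integral>\<^sup>+x. g x \<partial>N s) \<in> borel_measurable P"
  by (intro nn_integral_measurable_subprob_algebra2) measurable

lemma N_measurable: "A \<in> sets borel \<Longrightarrow> (\<lambda>s. emeasure (N s) A) \<in> borel_measurable P"
  using N_kernel by (rule measurable_emeasure_kernel)

section \<open>Lower bound on the flux and time-integrated mass of dyadic blocks\<close>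

lemma F_lower:
  assumes s: "s \<in> space P" and z: "0 < z"
  shows "ennreal (c1 * 2 powr (- \<bar>a\<bar> - \<bar>b - 1\<bar>) * z powr (a + b - 1)) * emeasure (N s) {z/2<..z} ^ 2 \<le> F s z"
proof -
  let ?c = "c1 * 2 powr (- \<bar>a\<bar> - \<bar>b - 1\<bar>) * z powr (a + b - 1)"
  let ?I = "indicator {z/2<..z} :: real \<Rightarrow> ennreal"
  have "ennreal ?c * emeasure (N s) {z/2<..z} ^ 2 = (\<integral>\<^sup>+x. \<integral>\<^sup>+y. ennreal ?c * (?I x * ?I y) \<partial>N s \<partial>N s)"
  proof -
    have "(\<integral>\<^sup>+y. ennreal ?c * (?I x * ?I y) \<partial>N s) = (ennreal ?c * emeasure (N s) {z/2<..z}) * ?I x" for x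
      using nn_integral_cmult_indicator[of "{z/2<..z}" "N s" "ennreal ?c * ?I x"] sets_N[OF s]
      by (simp add: mult_ac)
    then show ?thesis
      using nn_integral_cmult_indicator[of "{z/2<..z}" "N s" "ennreal ?c * emeasure (N s) {z/2<..z}"] sets_N[OF s]
      by (simp add: power2_eq_square mult_ac)
  qed
  also have "\<dots> \<le> F s z"
    unfolding F_def
  proof (intro nn_integral_mono)
    fix x y :: real
    show "ennreal ?c * (?I x * ?I y) \<le> ennreal (W x y) * indicator (Omega z) (x, y)"
    proof (cases "x \<in> {z/2<..z} \<and> y \<in> {z/2<..z}")
      case True
      then have xy: "0 < x" "0 < y" using z by auto
      have "?c = c1 * ((2 powr (- \<bar>a\<bar>) * z powr a) * (2 powr (- \<bar>b - 1\<bar>) * z powr (b - 1)))"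
      proof -
        have "a + b - 1 = a + (b - 1)" "- \<bar>a\<bar> - \<bar>b - 1\<bar> = - \<bar>a\<bar> + - \<bar>b - 1\<bar>" by simp_all
        then show ?thesis by (simp only: powr_add mult_ac)
      qed
      also have "\<dots> \<le> c1 * (x powr a * y powr (b - 1))"
        using z True c1_pos by (intro mult_left_mono mult_mono powr_comparable) auto
      also have "\<dots> \<le> W x y" using xy by (rule W_lower)
      finally have "?c \<le> W x y" .
      \<comment> \<open>Both coordinates exceed z/2, so x + y > z. The block is open on the left
        because x = y = z/2 would only give x + y = z.\<close>
      moreover have "(x, y) \<in> Omega z" using True xy by (auto simp: Omega_def)
      ultimately show ?thesis using True by (simp add: ennreal_leI)
    qed (auto split: split_indicator)
  qed
  finally show ?thesis .
qed

text \<open>The leading 2 counts the two half-open blocks that cover \<open>{z/2..z}\<close>, and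
  \<open>2 powr \<delta>\<close> accounts for their right ends lying below
  \<open>2 * z\<close>.\<close>

definition dyadic_const :: "real \<Rightarrow> real" where
  "dyadic_const B = 2 * 2 powr \<delta> * (measure P (space P) + B / (c1 * 2 powr (- \<bar>a\<bar> - \<bar>b - 1\<bar>)))"

text \<open>The quadratic lower bound becomes a linear one through n \<le> \<theta> + n^2/\<theta>,
  applied at each time and then integrated. The flux bound is known only for almost every z, so the
  closed block is covered by half-open blocks ending at good points.\<close>

lemma dyadic_mass:
  assumes good: "AE z in lborel. z > 0 \<longrightarrow> (\<integral>\<^sup>+s. F s z \<partial>P) \<le> ennreal B" and B: "0 \<le> B" and z: "0 < z"
  shows "(\<integral>\<^sup>+s. emeasure (N s) {z/2..z} \<partial>P) \<le> ennreal (dyadic_const B * z powr \<delta>)"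
proof -
  define k where "k = c1 * 2 powr (- \<bar>a\<bar> - \<bar>b - 1\<bar>)"
  define D where "D = measure P (space P) + B / k"
  have k: "0 < k" using c1_pos by (simp add: k_def)
  have D: "0 \<le> D" using B k by (simp add: D_def)
  have half_open: "(\<integral>\<^sup>+s. emeasure (N s) {w/2<..w} \<partial>P) \<le> ennreal (D * w powr \<delta>)"
    if w: "0 < w" and Fw: "(\<integral>\<^sup>+s. F s w \<partial>P) \<le> ennreal B" for w
  proof -
    \<comment> \<open>The factor in \<open>F_lower\<close> is k/\<theta>^2, so with this threshold
      both contributions are of order \<theta>.\<close>
    define \<theta> where "\<theta> = w powr \<delta>"
    have \<theta>: "0 < \<theta>" using w by (simp add: \<theta>_def)
    have \<theta>2: "w powr (a + b - 1) = 1 / (\<theta> * \<theta>)"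
      using w by (simp add: \<theta>_def powr_add[symmetric] \<delta>_def powr_minus_divide[symmetric])
    have pt: "emeasure (N s) {w/2<..w} \<le> ennreal \<theta> + ennreal (\<theta> / k) * F s w" if s: "s \<in> space P" for s
    proof -
      interpret S: subprob_space "N s" using s by (rule subprob_N)
      define n where "n = measure (N s) {w/2<..w}"
      have n: "0 \<le> n" "emeasure (N s) {w/2<..w} = ennreal n" by (auto simp: n_def S.emeasure_eq_measure)
      \<comment> \<open>Either n is below the threshold \<theta>, or n/\<theta> > 1 and the
        quadratic term alone suffices.\<close>
      have "n \<le> \<theta> + n\<^sup>2 / \<theta>"
      proof (cases "n \<le> \<theta>")
        case False
        then have "n \<le> n\<^sup>2 / \<theta>" using \<theta> by (simp add: pos_le_divide_eq power2_eq_square)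
        then show ?thesis using \<theta> by linarith
      qed (use \<theta> in \<open>simp add: add_increasing2\<close>)
      then have "ennreal n \<le> ennreal (\<theta> + n\<^sup>2 / \<theta>)"
        by (rule ennreal_leI)
      also have "n\<^sup>2 / \<theta> = (\<theta> / k) * ((k * (1 / (\<theta> * \<theta>))) * n\<^sup>2)"
        using k \<theta> by (simp add: field_simps)
      also have "ennreal (\<theta> + (\<theta> / k) * ((k * (1 / (\<theta> * \<theta>))) * n\<^sup>2))
          = ennreal \<theta> + ennreal (\<theta> / k) * (ennreal (k * (1 / (\<theta> * \<theta>))) * (ennreal n)\<^sup>2)"
        using k \<theta> n(1) by (subst ennreal_plus, simp, simp, subst ennreal_mult, simp, simp, subst ennreal_mult)
          (simp_all only: ennreal_power, simp_all)
      also have "\<dots> \<le> ennreal \<theta> + ennreal (\<theta> / k) * F s w"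
        using F_lower[OF s w] unfolding n(2) \<theta>2 k_def[symmetric] by (intro add_left_mono mult_left_mono) auto
      finally show ?thesis using n by simp
    qed
    have "(\<integral>\<^sup>+s. emeasure (N s) {w/2<..w} \<partial>P) \<le> (\<integral>\<^sup>+s. ennreal \<theta> + ennreal (\<theta> / k) * F s w \<partial>P)"
      by (intro nn_integral_mono pt)
    also have "\<dots> = ennreal \<theta> * emeasure P (space P) + ennreal (\<theta> / k) * (\<integral>\<^sup>+s. F s w \<partial>P)"
      using F_measurable1[of w] by (simp add: nn_integral_add nn_integral_cmult)
    also have "\<dots> \<le> ennreal \<theta> * emeasure P (space P) + ennreal (\<theta> / k) * ennreal B"
      by (intro add_left_mono mult_left_mono Fw) auto
    also have "\<dots> = ennreal (D * \<theta>)"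
      using \<theta> k B by (simp add: emeasure_eq_measure ennreal_mult[symmetric] ennreal_plus[symmetric] D_def
          del: ennreal_plus) (simp add: algebra_simps)
    finally show ?thesis by (simp add: \<theta>_def)
  qed
  \<comment> \<open>With \<open>z2\<close> chosen next, z1/2 < z/2, z2/2 < 5z/8 < 3z/4 < z1 and z <
    z2, so the blocks ending at \<open>z1\<close> and \<open>z2\<close> together cover
    \<open>{z/2..z}\<close>.\<close>
  obtain z1 where z1: "3 * z / 4 < z1" "z1 < z" "(\<integral>\<^sup>+s. F s z1 \<partial>P) \<le> ennreal B"
    using AE_positive_obtain[OF good, of "3 * z / 4" z] z by auto
  obtain z2 where z2: "z < z2" "z2 < 5 * z / 4" "(\<integral>\<^sup>+s. F s z2 \<partial>P) \<le> ennreal B"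
    using AE_positive_obtain[OF good, of z "5 * z / 4"] z by auto
  have "(\<integral>\<^sup>+s. emeasure (N s) {z/2..z} \<partial>P)
      \<le> (\<integral>\<^sup>+s. emeasure (N s) {z1/2<..z1} + emeasure (N s) {z2/2<..z2} \<partial>P)"
  proof (rule nn_integral_mono)
    fix s assume s: "s \<in> space P"
    note [simp] = sets_N[OF s]
    have "emeasure (N s) {z/2..z} \<le> emeasure (N s) ({z1/2<..z1} \<union> {z2/2<..z2})"
      using z1 z2 by (intro emeasure_mono) auto
    also have "\<dots> \<le> emeasure (N s) {z1/2<..z1} + emeasure (N s) {z2/2<..z2}"
      by (rule emeasure_subadditive) auto
    finally show "emeasure (N s) {z/2..z} \<le> \<dots>" .
  qed
  also have "\<dots> = (\<integral>\<^sup>+s. emeasure (N s) {z1/2<..z1} \<partial>P) + (\<integral>\<^sup>+s. emeasure (N s) {z2/2<..z2} \<partial>P)"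
    by (intro nn_integral_add N_measurable) auto
  also have "\<dots> \<le> ennreal (D * z1 powr \<delta>) + ennreal (D * z2 powr \<delta>)"
    using z1 z2 z by (intro add_mono half_open) auto
  also have "\<dots> \<le> ennreal (D * (2 * z) powr \<delta>) + ennreal (D * (2 * z) powr \<delta>)"
    using z1 z2 z D \<delta>_pos by (intro add_mono ennreal_leI mult_left_mono powr_mono2) auto
  also have "\<dots> = ennreal (dyadic_const B * z powr \<delta>)"
    using D z by (simp add: ennreal_plus[symmetric] dyadic_const_def k_def[symmetric] D_def[symmetric] powr_mult
        del: ennreal_plus)
  finally show ?thesis .
qed

section \<open>Moments near zero, summed over dyadic blocks\<close>

definition moment_const :: "real \<Rightarrow> real \<Rightarrow> real" where
  "moment_const p C = 2 powr \<bar>p\<bar> * C / (1 - 2 powr - (p + \<delta>))"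

lemma moment_const_nonneg: "0 < p + \<delta> \<Longrightarrow> 0 \<le> C \<Longrightarrow> 0 \<le> moment_const p C"
  unfolding moment_const_def by (intro divide_nonneg_nonneg mult_nonneg_nonneg) (use powr_less_cancel_iff[of 2 "- (p + \<delta>)" 0] in auto)

text \<open>On the block ending at R 2^(-k) the power is comparable with its value at the right end,
  and the time-integrated mass is O((R 2^(-k))^\<delta>). The contributions form a geometric series
  of ratio 2^(-(p + \<delta>)), convergent even for some negative p.\<close>

lemma truncated_moment:
  assumes dyadic: "\<And>z. 0 < z \<Longrightarrow> (\<integral>\<^sup>+s. emeasure (N s) {z/2..z} \<partial>P) \<le> ennreal (C * z powr \<delta>)"
    and C: "0 \<le> C" and p: "0 < p + \<delta>" and R: "0 < R"
  shows "(\<integral>\<^sup>+s. (\<integral>\<^sup>+x\<in>{0<..R}. ennreal (x powr p) \<partial>N s) \<partial>P) \<le> ennreal (moment_const p C * R powr (p + \<delta>))"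
proof -
  define r where "r k = R * 2 powr (- real k)" for k
  define q where "q = 2 powr - (p + \<delta>)"
  define c where "c k = 2 powr \<bar>p\<bar> * r k powr p" for k
  have r: "0 < r k" for k using R by (simp add: r_def)
  have q: "0 < q" "q < 1" using p by (auto simp: q_def powr_less_one)
  have c: "0 \<le> c k" for k by (simp add: c_def)
  have pt: "ennreal (x powr p) * indicator {0<..R} x \<le> (\<Sum>k. ennreal (c k) * indicator {r k/2..r k} x)" for x
  proof (cases "x \<in> {0<..R}")
    case True
    \<comment> \<open>This is the k with 2^k \<le> R/x < 2^(k+1), which puts x in the k-th block.
      Neighbouring closed blocks share an endpoint, harmless for an upper bound.\<close>
    define k where "k = nat \<lfloor>log 2 (R / x)\<rfloor>"
    have "0 \<le> log 2 (R / x)" using True by auto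
    then have "real k \<le> log 2 (R / x)" "log 2 (R / x) < real k + 1"
      unfolding k_def by linarith+
    then have "2 powr real k \<le> R / x" "R / x < 2 powr (real k + 1)"
      using True R by (auto simp: le_log_iff log_less_iff)
    then have x: "r k / 2 \<le> x" "x \<le> r k"
      using True by (auto simp: r_def powr_minus powr_add field_simps)
    then have "x powr p \<le> c k"
      unfolding c_def using r[of k] by (intro powr_comparable) auto
    then have "ennreal (x powr p) * indicator {0<..R} x \<le> ennreal (c k) * indicator {r k/2..r k} x"
      using True x by (simp add: ennreal_leI)
    also have "\<dots> \<le> (\<Sum>k. ennreal (c k) * indicator {r k/2..r k} x)"
    proof -
      define g where "g k = ennreal (c k) * indicator {r k/2..r k} x" for k
      have "g k \<le> (\<Sum>k. g k)" using sum_le_suminf[of g "{k}"] by simp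
      then show ?thesis by (simp add: g_def)
    qed
    finally show ?thesis .
  qed simp
  have "(\<integral>\<^sup>+s. (\<integral>\<^sup>+x\<in>{0<..R}. ennreal (x powr p) \<partial>N s) \<partial>P)
      \<le> (\<integral>\<^sup>+s. (\<Sum>k. ennreal (c k) * emeasure (N s) {r k/2..r k}) \<partial>P)"
  proof (rule nn_integral_mono)
    fix s assume s: "s \<in> space P"
    have [simp, measurable]: "{r k/2..r k} \<in> sets (N s)" for k using sets_N[OF s] by simp
    have "(\<integral>\<^sup>+x\<in>{0<..R}. ennreal (x powr p) \<partial>N s) \<le> (\<integral>\<^sup>+x. (\<Sum>k. ennreal (c k) * indicator {r k/2..r k} x) \<partial>N s)"
      by (intro nn_integral_mono pt)
    also have "\<dots> = (\<Sum>k. ennreal (c k) * emeasure (N s) {r k/2..r k})"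
      by (subst nn_integral_suminf) (simp_all add: nn_integral_cmult_indicator)
    finally show "(\<integral>\<^sup>+x\<in>{0<..R}. ennreal (x powr p) \<partial>N s) \<le> \<dots>" .
  qed
  also have "\<dots> = (\<Sum>k. ennreal (c k) * (\<integral>\<^sup>+s. emeasure (N s) {r k/2..r k} \<partial>P))"
    using N_measurable by (simp add: nn_integral_suminf nn_integral_cmult)
  also have "\<dots> \<le> (\<Sum>k. ennreal (2 powr \<bar>p\<bar> * C * R powr (p + \<delta>) * q ^ k))"
  proof (intro suminf_le summableI)
    fix k
    have "r k powr (p + \<delta>) = R powr (p + \<delta>) * q ^ k"
      using R q by (simp add: r_def q_def powr_mult powr_powr powr_realpow[symmetric] algebra_simps)
    then have e: "c k * (C * r k powr \<delta>) = 2 powr \<bar>p\<bar> * C * R powr (p + \<delta>) * q ^ k"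
      by (simp add: c_def powr_add)
    have "ennreal (c k) * (\<integral>\<^sup>+s. emeasure (N s) {r k/2..r k} \<partial>P) \<le> ennreal (c k) * ennreal (C * r k powr \<delta>)"
      by (intro mult_left_mono dyadic r) auto
    also have "\<dots> = ennreal (c k * (C * r k powr \<delta>))"
      using C c by (simp add: ennreal_mult)
    finally show "ennreal (c k) * (\<integral>\<^sup>+s. emeasure (N s) {r k/2..r k} \<partial>P)
        \<le> ennreal (2 powr \<bar>p\<bar> * C * R powr (p + \<delta>) * q ^ k)"
      unfolding e .
  qed
  also have "\<dots> = ennreal (2 powr \<bar>p\<bar> * C * R powr (p + \<delta>) * (1 / (1 - q)))"
    using q C by (intro suminf_ennreal_eq sums_mult geometric_sums) auto
  also have "2 powr \<bar>p\<bar> * C * R powr (p + \<delta>) * (1 / (1 - q)) = moment_const p C * R powr (p + \<delta>)"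
    by (simp add: moment_const_def q_def)
  finally show ?thesis .
qed

section \<open>Upper bound on the flux averaged over a dyadic range of z\<close>

text \<open>For fixed \<open>(x, y)\<close> the indicator of \<open>Omega z\<close>, integrated over \<open>z \<in> [R, 2R]\<close>, is at most
  \<open>min y R\<close>, and it vanishes unless \<open>x \<le> 2R\<close> and \<open>x + y > R\<close>. The gain \<open>min y R\<close> compensates
  the singularity of \<open>y powr (q - 1)\<close> at small \<open>y\<close>.\<close>

lemma averaged_kernel_term:
  fixes x y p q R :: real
  assumes xy: "0 < x" "0 < y" "x \<le> 2 * R" "R < x + y" and q: "q < 1" and R: "0 < R"
  shows "x powr p * y powr (q - 1) * min y R
    \<le> 2 powr (2 + \<bar>p\<bar> + \<bar>q\<bar>) * (R powr q * x powr p + R powr p * (y powr q * indicator {0<..2 * R} y))"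
proof (cases "R / 2 \<le> y")
  case True
  \<comment> \<open>Away from zero the power of y is not singular: it decreases because q < 1, and
    \<open>min y R\<close> is estimated by R.\<close>
  have "y powr (q - 1) \<le> (R / 2) powr (q - 1)"
    using True q R by (intro powr_mono2') auto
  also have "\<dots> = 2 powr (1 - q) * R powr (q - 1)"
    using R by (simp add: powr_divide powr_diff field_simps)
  also have "\<dots> \<le> 2 powr (2 + \<bar>p\<bar> + \<bar>q\<bar>) * R powr (q - 1)"
    by (intro mult_right_mono powr_mono) auto
  finally have "y powr (q - 1) \<le> 2 powr (2 + \<bar>p\<bar> + \<bar>q\<bar>) * R powr (q - 1)" .
  then have "x powr p * y powr (q - 1) * min y R \<le> x powr p * (2 powr (2 + \<bar>p\<bar> + \<bar>q\<bar>) * R powr (q - 1)) * R"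
    using xy R by (intro mult_mono) auto
  also have "\<dots> = 2 powr (2 + \<bar>p\<bar> + \<bar>q\<bar>) * (R powr q * x powr p)"
    using R by (simp add: powr_diff)
  also have "\<dots> \<le> 2 powr (2 + \<bar>p\<bar> + \<bar>q\<bar>) * (R powr q * x powr p + R powr p * (y powr q * indicator {0<..2 * R} y))"
    by (intro mult_left_mono) auto
  finally show ?thesis .
next
  case False
  \<comment> \<open>Now y < R/2 and x + y > R force x > R/2, so x is comparable with R; the factor
    \<open>min y R\<close> is y and raises the exponent q - 1 to q.\<close>
  have "x powr p \<le> 2 powr \<bar>p\<bar> * R powr p"
    using False xy R by (intro powr_comparable) auto
  also have "\<dots> \<le> 2 powr (2 + \<bar>p\<bar> + \<bar>q\<bar>) * R powr p"
    by (intro mult_right_mono powr_mono) auto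
  finally have "x powr p \<le> 2 powr (2 + \<bar>p\<bar> + \<bar>q\<bar>) * R powr p" .
  moreover have "y powr (q - 1) * min y R = y powr q"
    using False xy R by (simp add: powr_diff)
  ultimately have "x powr p * y powr (q - 1) * min y R \<le> 2 powr (2 + \<bar>p\<bar> + \<bar>q\<bar>) * R powr p * y powr q"
    using mult_right_mono[of "x powr p" _ "y powr q"] by (metis (no_types) mult.assoc powr_ge_zero)
  also have "\<dots> = 2 powr (2 + \<bar>p\<bar> + \<bar>q\<bar>) * (R powr p * (y powr q * indicator {0<..2 * R} y))"
    using False xy R by simp
  also have "\<dots> \<le> 2 powr (2 + \<bar>p\<bar> + \<bar>q\<bar>) * (R powr q * x powr p + R powr p * (y powr q * indicator {0<..2 * R} y))"
    by (intro mult_left_mono) auto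
  finally show ?thesis .
qed

definition avg_const :: real where
  "avg_const = c2 * 2 powr (2 + \<bar>a\<bar> + \<bar>b\<bar>)"

lemma avg_const_nonneg: "0 \<le> avg_const"
  using c2_pos by (simp add: avg_const_def)

text \<open>A function of one variable: the averaged kernel is dominated by a sum over the two
  coordinates, so its double integral reduces to single moments.\<close>

definition avg_bound :: "real \<Rightarrow> real \<Rightarrow> real" where
  "avg_bound R x = avg_const *
     (R powr b * (x powr a * indicator {0<..2*R} x) + R powr a * (x powr b * indicator {0<..2*R} x))"

lemma avg_bound_nonneg: "0 \<le> avg_bound R x"
  using avg_const_nonneg by (simp add: avg_bound_def)

lemma Omega_average:
  assumes R: "0 < R"
  shows "(\<integral>\<^sup>+z\<in>{R..2*R}. (ennreal (W x y) * indicator (Omega z) (x, y)) \<partial>lborel) \<le> ennreal (avg_bound R x + avg_bound R y)"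
proof (cases "0 < x \<and> 0 < y \<and> x \<le> 2 * R \<and> R < x + y")
  case True
  then have xy: "0 < x" "0 < y" "x \<le> 2 * R" "R < x + y" by auto
  \<comment> \<open>For positive x and y, membership in \<open>Omega z\<close> means x \<le> z < x +
    y.\<close>
  have "(\<integral>\<^sup>+z\<in>{R..2*R}. (ennreal (W x y) * indicator (Omega z) (x, y)) \<partial>lborel)
      = (\<integral>\<^sup>+z. ennreal (W x y) * indicator ({x..<x+y} \<inter> {R..2*R}) z \<partial>lborel)"
    using xy by (intro nn_integral_cong) (auto simp: Omega_def split: split_indicator)
  also have "\<dots> = ennreal (W x y) * emeasure lborel ({x..<x+y} \<inter> {R..2*R})"
    by (rule nn_integral_cmult_indicator) auto
  also have "\<dots> \<le> ennreal (W x y) * ennreal (min y R)"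
  proof (rule mult_left_mono)
    have "emeasure lborel ({x..<x+y} \<inter> {R..2*R}) \<le> emeasure lborel {x..<x+y}"
      "emeasure lborel ({x..<x+y} \<inter> {R..2*R}) \<le> emeasure lborel {R..2*R}"
      by (auto intro!: emeasure_mono)
    then show "emeasure lborel ({x..<x+y} \<inter> {R..2*R}) \<le> ennreal (min y R)"
      using xy R by (simp add: min_def)
  qed simp
  also have "\<dots> = ennreal (W x y * min y R)"
    using xy R by (simp add: ennreal_mult'')
  also have "W x y * min y R \<le> c2 * (x powr a * y powr (b - 1) + x powr b * y powr (a - 1)) * min y R"
    using xy R W_upper[OF xy(1,2)] by (intro mult_right_mono) auto
  also have "\<dots> = c2 * (x powr a * y powr (b - 1) * min y R + x powr b * y powr (a - 1) * min y R)"
    by (simp add: algebra_simps)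
  \<comment> \<open>The two kernel terms are \<open>averaged_kernel_term\<close> with exponents (a,
    b) and (b, a).\<close>
  also have "\<dots> \<le> c2 * (2 powr (2 + \<bar>a\<bar> + \<bar>b\<bar>) * (R powr b * x powr a + R powr a * (y powr b * indicator {0<..2 * R} y))
     + 2 powr (2 + \<bar>b\<bar> + \<bar>a\<bar>) * (R powr a * x powr b + R powr b * (y powr a * indicator {0<..2 * R} y)))"
    using xy R c2_pos a_less b_less by (intro mult_left_mono add_mono averaged_kernel_term) auto
  also have "\<dots> = avg_bound R x + avg_bound R y"
    using xy by (simp add: avg_bound_def avg_const_def algebra_simps)
  finally show ?thesis by (simp add: ennreal_leI)
next
  case False
  have "(\<integral>\<^sup>+z\<in>{R..2*R}. (ennreal (W x y) * indicator (Omega z) (x, y)) \<partial>lborel) = (\<integral>\<^sup>+(z::real). 0 \<partial>lborel)"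
    by (intro nn_integral_cong) (use False R in \<open>auto simp: Omega_def split: split_indicator\<close>)
  then show ?thesis by simp
qed

text \<open>Tonelli moves the average over z inside, where \<open>Omega_average\<close> separates
  the variables. The free variable contributes a total mass of at most 1, and the two symmetric
  summands give the factor 2.\<close>

lemma F_average:
  assumes s: "s \<in> space P" and R: "0 < R"
  shows "(\<integral>\<^sup>+z\<in>{R..2*R}. F s z \<partial>lborel)
    \<le> ennreal (2 * avg_const) * (ennreal (R powr b) * (\<integral>\<^sup>+x\<in>{0<..2*R}. ennreal (x powr a) \<partial>N s)
        + ennreal (R powr a) * (\<integral>\<^sup>+x\<in>{0<..2*R}. ennreal (x powr b) \<partial>N s))"
proof -
  interpret S: subprob_space "N s" using s by (rule subprob_N)
  interpret S2: pair_sigma_finite "N s" "N s" ..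
  interpret L: pair_sigma_finite "N s \<Otimes>\<^sub>M N s" lborel ..
  have sN [measurable_cong]: "sets (N s) = sets borel" using sets_N[OF s] .
  have sN2: "sets (N s \<Otimes>\<^sub>M N s) = sets (borel \<Otimes>\<^sub>M borel)"
    by (intro sets_pair_measure_cong sN)
  have sN3: "sets ((N s \<Otimes>\<^sub>M N s) \<Otimes>\<^sub>M lborel) = sets ((borel \<Otimes>\<^sub>M borel) \<Otimes>\<^sub>M borel)"
    by (intro sets_pair_measure_cong sN2 sets_lborel)
  have i: "indicator (Omega (snd w)) (fst w) = (indicator {w. (fst (fst w), snd (fst w)) \<in> Omega (snd w)} w :: ennreal)"
    for w :: "(real \<times> real) \<times> real"
    by (simp split: split_indicator)
  have m: "(\<lambda>(v, z). ennreal (W (fst v) (snd v)) * indicator (Omega z) v * indicator {R..2*R} z)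
      \<in> borel_measurable ((N s \<Otimes>\<^sub>M N s) \<Otimes>\<^sub>M lborel)"
    unfolding split_beta' i measurable_cong_sets[OF sN3 refl] by measurable
  have m1: "(\<lambda>v. ennreal (W (fst v) (snd v)) * indicator (Omega z) v) \<in> borel_measurable (N s \<Otimes>\<^sub>M N s)" for z
  proof -
    have i: "indicator (Omega z) v = (indicator {v. (fst v, snd v) \<in> Omega z} v :: ennreal)" for v
      by (simp split: split_indicator)
    show ?thesis unfolding i measurable_cong_sets[OF sN2 refl] by measurable
  qed
  define G where "G p = (\<integral>\<^sup>+x\<in>{0<..2*R}. ennreal (x powr p) \<partial>N s)" for p
  define I where "I = (\<integral>\<^sup>+x. ennreal (avg_bound R x) \<partial>N s)"
  have phi [measurable]: "(\<lambda>x. ennreal (avg_bound R x)) \<in> borel_measurable (N s)"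
    unfolding avg_bound_def measurable_cong_sets[OF sN refl] by measurable
  have "(\<integral>\<^sup>+z\<in>{R..2*R}. F s z \<partial>lborel)
      = (\<integral>\<^sup>+z. (\<integral>\<^sup>+v. ennreal (W (fst v) (snd v)) * indicator (Omega z) v * indicator {R..2*R} z \<partial>(N s \<Otimes>\<^sub>M N s)) \<partial>lborel)"
    using S.nn_integral_fst[OF m1] m1 by (simp add: F_def nn_integral_multc)
  also have "\<dots> = (\<integral>\<^sup>+v. (\<integral>\<^sup>+z. ennreal (W (fst v) (snd v)) * indicator (Omega z) v * indicator {R..2*R} z \<partial>lborel) \<partial>(N s \<Otimes>\<^sub>M N s))"
    using m by (rule L.Fubini')
  also have "\<dots> \<le> (\<integral>\<^sup>+v. ennreal (avg_bound R (fst v)) + ennreal (avg_bound R (snd v)) \<partial>(N s \<Otimes>\<^sub>M N s))"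
    using Omega_average[OF R] avg_bound_nonneg
    by (intro nn_integral_mono) (auto simp: ennreal_plus[symmetric] simp del: ennreal_plus)
  also have "\<dots> = (\<integral>\<^sup>+x. \<integral>\<^sup>+y. ennreal (avg_bound R x) + ennreal (avg_bound R y) \<partial>N s \<partial>N s)"
    by (subst S.nn_integral_fst[symmetric]) auto
  also have "\<dots> = I * emeasure (N s) (space (N s)) + I * emeasure (N s) (space (N s))"
    by (simp add: nn_integral_add nn_integral_multc I_def)
  also have "\<dots> \<le> I * 1 + I * 1"
    by (intro mult_left_mono add_mono S.subprob_emeasure_le_1) auto
  also have "\<dots> = ennreal 2 * I" by (simp add: mult_2)
  also have "I = (\<integral>\<^sup>+x. ennreal avg_const * (ennreal (R powr b) * (ennreal (x powr a) * indicator {0<..2*R} x)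
      + ennreal (R powr a) * (ennreal (x powr b) * indicator {0<..2*R} x)) \<partial>N s)"
    unfolding I_def using avg_const_nonneg
    by (intro nn_integral_cong) (auto simp: avg_bound_def ennreal_mult split: split_indicator)
  also have "\<dots> = ennreal avg_const * (ennreal (R powr b) * G a + ennreal (R powr a) * G b)"
  proof -
    have [measurable]: "(\<lambda>x. ennreal (x powr p) * indicator {0<..2*R} x) \<in> borel_measurable (N s)" for p
      unfolding measurable_cong_sets[OF sN refl] by measurable
    show ?thesis by (simp add: nn_integral_cmult nn_integral_add G_def)
  qed
  also have "ennreal 2 * \<dots> = ennreal (2 * avg_const) * (ennreal (R powr b) * G a + ennreal (R powr a) * G b)"
    using avg_const_nonneg by (simp add: ennreal_mult mult.assoc)
  finally show ?thesis by (simp add: G_def)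
qed

section \<open>Decay of the time-integrated flux\<close>

definition decay_const :: "real \<Rightarrow> real" where
  "decay_const C = 2 * avg_const * (moment_const a C * 2 powr (a + \<delta>) + moment_const b C * 2 powr (b + \<delta>))"

text \<open>Both terms scale like R^(a + b + \<delta>), and a + b = 1 - 2\<delta> turns this into
  R^(1 - \<delta>): one power of R is the length of the averaging interval, the rest is
  decay.\<close>

lemma time_F_average:
  assumes dyadic: "\<And>z. 0 < z \<Longrightarrow> (\<integral>\<^sup>+s. emeasure (N s) {z/2..z} \<partial>P) \<le> ennreal (C * z powr \<delta>)"
    and C: "0 \<le> C" and R: "0 < R"
  shows "(\<integral>\<^sup>+z\<in>{R..2*R}. (\<integral>\<^sup>+s. F s z \<partial>P) \<partial>lborel) \<le> ennreal (decay_const C * R powr (1 - \<delta>))"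
proof -
  interpret PL: pair_sigma_finite P lborel ..
  define G where "G p s = (\<integral>\<^sup>+x\<in>{0<..2*R}. ennreal (x powr p) \<partial>N s)" for p s
  have Gm [measurable]: "G p \<in> borel_measurable P" for p
    unfolding G_def by (intro moment_measurable) measurable
  have GI: "(\<integral>\<^sup>+s. G p s \<partial>P) \<le> ennreal (moment_const p C * (2 * R) powr (p + \<delta>))" if "0 < p + \<delta>" for p
    unfolding G_def using dyadic C that R by (intro truncated_moment) auto
  have Fm: "(\<lambda>(s, z). F s z * indicator {R..2*R} z) \<in> borel_measurable (P \<Otimes>\<^sub>M lborel)"
    using F_measurable by measurable
  have "(\<integral>\<^sup>+z\<in>{R..2*R}. (\<integral>\<^sup>+s. F s z \<partial>P) \<partial>lborel) = (\<integral>\<^sup>+z. (\<integral>\<^sup>+s. F s z * indicator {R..2*R} z \<partial>P) \<partial>lborel)"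
    using F_measurable1 by (simp add: nn_integral_multc)
  also have "\<dots> = (\<integral>\<^sup>+s. (\<integral>\<^sup>+z. F s z * indicator {R..2*R} z \<partial>lborel) \<partial>P)"
    using Fm by (rule PL.Fubini')
  also have "\<dots> \<le> (\<integral>\<^sup>+s. ennreal (2 * avg_const) * (ennreal (R powr b) * G a s + ennreal (R powr a) * G b s) \<partial>P)"
    unfolding G_def using R by (intro nn_integral_mono F_average) auto
  also have "\<dots> = ennreal (2 * avg_const) * (ennreal (R powr b) * (\<integral>\<^sup>+s. G a s \<partial>P) + ennreal (R powr a) * (\<integral>\<^sup>+s. G b s \<partial>P))"
    by (simp add: nn_integral_cmult nn_integral_add)
  also have "\<dots> \<le> ennreal (2 * avg_const) * (ennreal (R powr b) * ennreal (moment_const a C * (2 * R) powr (a + \<delta>))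
      + ennreal (R powr a) * ennreal (moment_const b C * (2 * R) powr (b + \<delta>)))"
    by (intro mult_left_mono add_mono GI a_\<delta> b_\<delta>) auto
  also have "\<dots> = ennreal (2 * avg_const * (R powr b * (moment_const a C * (2 * R) powr (a + \<delta>))
      + R powr a * (moment_const b C * (2 * R) powr (b + \<delta>))))"
    using avg_const_nonneg moment_const_nonneg[OF a_\<delta> C] moment_const_nonneg[OF b_\<delta> C]
    by (simp add: ennreal_mult ennreal_plus)
  also have "2 * avg_const * (R powr b * (moment_const a C * (2 * R) powr (a + \<delta>))
      + R powr a * (moment_const b C * (2 * R) powr (b + \<delta>))) = decay_const C * R powr (1 - \<delta>)"
  proof -
    have "R powr (1 - \<delta>) = R powr (a + b + \<delta>)"
      by (rule arg_cong[where f = "\<lambda>e. R powr e"]) (simp add: \<delta>_def field_simps)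
    then show ?thesis
      using R by (simp only: decay_const_def) (simp add: powr_mult powr_add algebra_simps)
  qed
  finally show ?thesis .
qed

text \<open>A function cannot exceed its mean almost everywhere. \<open>Q\<close> is carried along
  so that the selected point is also one where the flux identity holds.\<close>

lemma small_time_flux:
  assumes dyadic: "\<And>z. 0 < z \<Longrightarrow> (\<integral>\<^sup>+s. emeasure (N s) {z/2..z} \<partial>P) \<le> ennreal (C * z powr \<delta>)"
    and C: "0 \<le> C" and R: "0 < R" and Q: "AE z in lborel. z > 0 \<longrightarrow> Q z"
  shows "\<exists>z\<in>{R..2*R}. Q z \<and> (\<integral>\<^sup>+s. F s z \<partial>P) \<le> ennreal ((decay_const C + 1) * R powr - \<delta>)"
proof (rule ccontr)
  \<comment> \<open>The added 1 makes this level strictly larger than the bound on the mean, even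
    when \<open>decay_const C\<close> is zero.\<close>
  let ?k = "ennreal ((decay_const C + 1) * R powr - \<delta>)"
  assume *: "\<not> ?thesis"
  have d: "0 \<le> decay_const C"
    using avg_const_nonneg moment_const_nonneg[OF a_\<delta> C] moment_const_nonneg[OF b_\<delta> C]
    by (simp add: decay_const_def)
  have "AE z in lborel. ?k * indicator {R..2*R} z \<le> (\<integral>\<^sup>+s. F s z \<partial>P) * indicator {R..2*R} z"
    using Q by eventually_elim (use * R in \<open>auto split: split_indicator simp: not_le intro: less_imp_le\<close>)
  then have "(\<integral>\<^sup>+z. ?k * indicator {R..2*R} z \<partial>lborel) \<le> (\<integral>\<^sup>+z\<in>{R..2*R}. (\<integral>\<^sup>+s. F s z \<partial>P) \<partial>lborel)"
    by (rule nn_integral_mono_AE)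
  also have "\<dots> \<le> ennreal (decay_const C * R powr (1 - \<delta>))"
    using dyadic C R by (rule time_F_average)
  also have "(\<integral>\<^sup>+z. ?k * indicator {R..2*R} z \<partial>lborel) = ?k * ennreal R"
    using R by (simp add: nn_integral_cmult_indicator)
  also have "\<dots> = ennreal ((decay_const C + 1) * R powr (1 - \<delta>))"
    using R d by (simp add: ennreal_mult[symmetric] powr_diff powr_minus field_simps)
  finally show False
    using d R by (simp add: ennreal_le_iff)
qed

end

section \<open>Weak* continuous curves of Radon measures\<close>

lemma radon_sets: "\<mu> \<in> radon_measures X \<Longrightarrow> sets \<mu> = sets (restrict_space borel X)"
  by (simp add: radon_measures_def)

lemma radon_space: "\<mu> \<in> radon_measures X \<Longrightarrow> space \<mu> = X"
  using sets_eq_imp_space_eq[OF radon_sets] by (auto simp: space_restrict_space)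

lemma radon_measurable: "\<mu> \<in> radon_measures X \<Longrightarrow> g \<in> measurable borel L \<Longrightarrow> g \<in> measurable \<mu> L"
  using measurable_restrict_space1[of g borel L X] measurable_cong_sets[OF radon_sets refl] by blast

lemma radon_pair_measurable:
  assumes "\<mu> \<in> radon_measures X" "g \<in> measurable (borel \<Otimes>\<^sub>M borel) L"
  shows "g \<in> measurable (\<mu> \<Otimes>\<^sub>M \<mu>) L"
proof -
  have [measurable]: "(\<lambda>x. x) \<in> measurable \<mu> borel"
    using assms(1) by (rule radon_measurable) measurable
  have "(\<lambda>p. (fst p, snd p)) \<in> measurable (\<mu> \<Otimes>\<^sub>M \<mu>) (borel \<Otimes>\<^sub>M borel)"
    by (intro measurable_Pair measurable_compose[OF measurable_fst] measurable_compose[OF measurable_snd]) measurable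
  from measurable_compose[OF this assms(2)] show ?thesis by simp
qed

text \<open>The half-line is exhausted by the compact intervals [1/(n+1), n+1]; this gives access to
  Tonelli for the double integral in the flux.\<close>

lemma radon_sigma_finite:
  fixes \<mu> :: "real measure"
  assumes mu: "\<mu> \<in> radon_measures {0<..}"
  shows "sigma_finite_measure \<mu>"
proof (unfold_locales, intro exI conjI)
  let ?A = "range (\<lambda>n. {1 / real (Suc n)..real (Suc n)})"
  have pos: "{1 / real (Suc n)..real (Suc n)} \<subseteq> {0<..}" for n
  proof
    fix x assume "x \<in> {1 / real (Suc n)..real (Suc n)}"
    moreover have "0 < 1 / real (Suc n)" by simp
    ultimately show "x \<in> {0<..}" unfolding atLeastAtMost_iff greaterThan_iff by linarith
  qed
  show "countable ?A" by simp
  show "?A \<subseteq> sets \<mu>"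
    using radon_sets[OF mu] pos by (auto simp: sets_restrict_space_iff simp del: of_nat_Suc)
  show "\<Union>?A = space \<mu>"
  proof (intro set_eqI iffI)
    fix x assume "x \<in> space \<mu>"
    then have x: "0 < x" using radon_space[OF mu] by simp
    obtain m where m: "x < real m" using reals_Archimedean2 by blast
    obtain n where n: "1 / x < real n" using reals_Archimedean2 by blast
    have "x \<le> real (Suc (m + n))" using m by simp
    moreover have "1 / x \<le> real (Suc (m + n))" using n by simp
    then have "1 / real (Suc (m + n)) \<le> x" using x by (simp add: field_simps)
    ultimately show "x \<in> \<Union>?A" by (auto simp del: of_nat_Suc)
  qed (use radon_space[OF mu] pos in blast)
  show "\<forall>a\<in>?A. emeasure \<mu> a \<noteq> \<infinity>"
  proof
    fix a assume "a \<in> ?A"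
    then have "compact a" "a \<subseteq> {0<..}" using pos by auto
    then show "emeasure \<mu> a \<noteq> \<infinity>" using mu by (auto simp: radon_measures_def)
  qed
qed

section \<open>The first moment and its truncations\<close>

lemma M1_eq_emeasure:
  assumes mu: "\<mu> \<in> radon_measures {0<..}"
  shows "M1 \<mu> = emeasure (x_times \<mu>) (space (x_times \<mu>))"
proof -
  have [measurable]: "(\<lambda>x. x) \<in> borel_measurable \<mu>" using mu by (rule radon_measurable) measurable
  show ?thesis unfolding M1_def x_times_def by (simp add: emeasure_density nn_set_integral_space)
qed

lemma mass_upto_le_M1: "mass_upto \<mu> z \<le> M1 \<mu>"
  unfolding mass_upto_def M1_def by (intro nn_integral_mono) (auto split: split_indicator)

lemma mass_upto_mono: "y \<le> z \<Longrightarrow> mass_upto \<mu> y \<le> mass_upto \<mu> z"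
  unfolding mass_upto_def by (intro nn_integral_mono) (auto split: split_indicator)

lemma SUP_mass_upto:
  assumes mu: "\<mu> \<in> radon_measures {0<..}"
  shows "(SUP n. mass_upto \<mu> (real n)) = M1 \<mu>"
proof -
  have "(SUP n. mass_upto \<mu> (real n)) = (\<integral>\<^sup>+x. (SUP n. ennreal x * indicator {0<..real n} x) \<partial>\<mu>)"
    unfolding mass_upto_def
    by (subst nn_integral_monotone_convergence_SUP)
      (auto simp: incseq_def le_fun_def split: split_indicator intro!: radon_measurable[OF mu])
  also have "\<dots> = M1 \<mu>"
    unfolding M1_def
  proof (rule nn_integral_cong)
    fix x assume "x \<in> space \<mu>"
    then have x: "0 < x" using radon_space[OF mu] by simp
    obtain m where m: "x < real m" using reals_Archimedean2 by blast
    show "(SUP n. ennreal x * indicator {0<..real n} x) = ennreal x"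
    proof (rule antisym)
      show "ennreal x \<le> (SUP n. ennreal x * indicator {0<..real n} x)"
        using x m by (intro SUP_upper2[of m]) auto
    qed (auto intro!: SUP_least split: split_indicator)
  qed
  finally show ?thesis .
qed

text \<open>The sequence is squeezed between the truncations at n and the full moment. It is
  otherwise arbitrary, since good values of z cannot be prescribed.\<close>

lemma mass_upto_tendsto:
  assumes mu: "\<mu> \<in> radon_measures {0<..}" and z: "\<And>n. real n \<le> z n"
  shows "(\<lambda>n. mass_upto \<mu> (z n)) \<longlonglongrightarrow> M1 \<mu>"
proof (rule tendsto_sandwich)
  have "incseq (\<lambda>n. mass_upto \<mu> (real n))" by (auto simp: incseq_def intro: mass_upto_mono)
  from LIMSEQ_SUP[OF this] show "(\<lambda>n. mass_upto \<mu> (real n)) \<longlonglongrightarrow> M1 \<mu>"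
    by (simp add: SUP_mass_upto[OF mu])
  show "(\<lambda>n. M1 \<mu>) \<longlonglongrightarrow> M1 \<mu>" by simp
qed (auto intro!: always_eventually mass_upto_mono z mass_upto_le_M1)

section \<open>Compactly supported cutoffs increasing to an open interval\<close>

definition bump :: "real \<Rightarrow> real \<Rightarrow> nat \<Rightarrow> real \<Rightarrow> real" where
  "bump u v n x = max 0 (min 1 (real (Suc n) * min (x - u) (v - x) - 1))"

lemma bump_range: "0 \<le> bump u v n x" "bump u v n x \<le> 1"
  by (auto simp: bump_def)

lemma bump_measurable [measurable]: "bump u v n \<in> borel_measurable borel"
  unfolding bump_def by measurable

text \<open>The subtracted 1 in \<open>bump\<close> makes it vanish within 1/(n+1) of the ends, so
  the support stays away from 0 even when u = 0.\<close>

lemma bump_compactly_supported: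
  assumes "0 \<le> u"
  shows "bump u v n \<in> compactly_supported {0<..}"
  unfolding compactly_supported_def
proof (intro CollectI conjI exI)
  let ?C = "{u + 1 / real (Suc n)..v}"
  show "continuous_on {0<..} (bump u v n)"
    unfolding bump_def by (intro continuous_intros)
  show "compact ?C" by simp
  show "?C \<subseteq> {0<..}"
  proof
    fix x assume "x \<in> ?C"
    moreover have "0 < u + 1 / real (Suc n)" using assms by (intro add_nonneg_pos) auto
    ultimately show "x \<in> {0<..}" unfolding atLeastAtMost_iff greaterThan_iff by linarith
  qed
  show "\<forall>x\<in>{0<..} - ?C. bump u v n x = 0"
  proof
    fix x assume "x \<in> {0<..} - ?C"
    then have "x - u \<le> 1 / real (Suc n) \<or> v - x \<le> 0" by auto
    then have "real (Suc n) * min (x - u) (v - x) \<le> 1"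
    proof
      assume "x - u \<le> 1 / real (Suc n)"
      then have "min (x - u) (v - x) \<le> 1 / real (Suc n)" by linarith
      then show ?thesis by (simp add: field_simps del: of_nat_Suc)
    next
      assume "v - x \<le> 0"
      then have "min (x - u) (v - x) \<le> 0" by linarith
      then have "real (Suc n) * min (x - u) (v - x) \<le> 0" by (intro mult_nonneg_nonpos) auto
      then show ?thesis by linarith
    qed
    then show "bump u v n x = 0" unfolding bump_def by linarith
  qed
qed

lemma SUP_bump: "(SUP n. ennreal (bump u v n x)) = indicator {u<..<v} x"
proof (cases "u < x \<and> x < v")
  case True
  then have m: "0 < min (x - u) (v - x)" by auto
  obtain n where "2 / min (x - u) (v - x) < real n" using reals_Archimedean2 by blast
  then have "2 < real n * min (x - u) (v - x)" using m by (simp only: pos_divide_less_eq)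
  also have "\<dots> \<le> real (Suc n) * min (x - u) (v - x)" using m by (intro mult_right_mono) auto
  finally have "bump u v n x = 1" unfolding bump_def by linarith
  then have "1 \<le> (SUP n. ennreal (bump u v n x))" by (intro SUP_upper2[of n]) auto
  moreover have "(SUP n. ennreal (bump u v n x)) \<le> 1" by (intro SUP_least) (simp add: bump_range)
  ultimately show ?thesis using True by (auto intro: antisym)
next
  case False
  have "bump u v n x = 0" for n
  proof -
    have "real (Suc n) * min (x - u) (v - x) \<le> 0" using False by (intro mult_nonneg_nonpos) auto
    then show ?thesis unfolding bump_def by linarith
  qed
  then show ?thesis using False by simp
qed

lemma incseq_bump: "incseq (\<lambda>n. ennreal (bump u v n x))"
proof (rule incseq_SucI, rule ennreal_leI)
  fix n
  show "bump u v n x \<le> bump u v (Suc n) x"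
  proof (cases "0 \<le> min (x - u) (v - x)")
    case True
    then have "real (Suc n) * min (x - u) (v - x) \<le> real (Suc (Suc n)) * min (x - u) (v - x)"
      by (intro mult_right_mono) auto
    then show ?thesis unfolding bump_def by linarith
  next
    case False
    then have "real (Suc n) * min (x - u) (v - x) \<le> 0" by (intro mult_nonneg_nonpos) auto
    then show ?thesis unfolding bump_def by linarith
  qed
qed

text \<open>Weak* continuity only speaks about test functions; this expresses the measure of an open
  interval as a countable supremum of such integrals.\<close>

lemma emeasure_eq_SUP_bump:
  assumes "\<nu> \<in> bounded_radon_measures {0<..}"
  shows "(\<integral>\<^sup>+x. indicator {u<..<v} x \<partial>\<nu>) = (SUP n. ennreal (\<integral>x. bump u v n x \<partial>\<nu>))"
proof -
  have nu: "\<nu> \<in> radon_measures {0<..}" "emeasure \<nu> (space \<nu>) < \<infinity>"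
    using assms by (auto simp: bounded_radon_measures_def)
  interpret finite_measure \<nu> using nu(2) by (intro finite_measureI) auto
  have [measurable]: "bump u v n \<in> borel_measurable \<nu>" for n
    using nu(1) by (rule radon_measurable) measurable
  have "(\<integral>\<^sup>+x. indicator {u<..<v} x \<partial>\<nu>) = (\<integral>\<^sup>+x. (SUP n. ennreal (bump u v n x)) \<partial>\<nu>)"
    by (simp add: SUP_bump)
  also have "\<dots> = (SUP n. \<integral>\<^sup>+x. ennreal (bump u v n x) \<partial>\<nu>)"
    using incseq_bump by (intro nn_integral_monotone_convergence_SUP) (auto simp: incseq_def le_fun_def)
  \<comment> \<open>Finiteness of \<nu> makes the cutoffs integrable, so the Bochner integral is the
    true value and not the default 0.\<close>
  also have "\<dots> = (SUP n. ennreal (\<integral>x. bump u v n x \<partial>\<nu>))"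
    using bump_range by (intro SUP_cong refl nn_integral_eq_integral integrable_const_bound[where B = 1]) auto
  finally show ?thesis .
qed

section \<open>From almost every time to every time\<close>

lemma continuous_le_of_AE:
  fixes g :: "real \<Rightarrow> real"
  assumes g: "continuous_on {0..T} g" and T: "0 < T"
    and AE: "AE t in lborel. t \<in> {0..T} \<longrightarrow> g t \<le> c" and t: "t \<in> {0..T}"
  shows "g t \<le> c"
proof -
  define S where "S = {t \<in> {0..T}. g t \<le> c}"
  have AE': "AE t in lborel. t > 0 \<longrightarrow> (t \<in> {0..T} \<longrightarrow> g t \<le> c)" using AE by eventually_elim auto
  \<comment> \<open>A subset of full measure is dense, and an inequality for a continuous function
    extends to the closure.\<close>
  have "{0..T} \<subseteq> closure S"
  proof
    fix t assume t: "t \<in> {0..T}"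
    show "t \<in> closure S"
      unfolding closure_approachable
    proof (intro allI impI)
      fix e :: real assume e: "0 < e"
      obtain s where "max 0 (t - e) < s" "s < min T (t + e)" "s \<in> {0..T} \<longrightarrow> g s \<le> c"
        by (rule AE_positive_obtain[OF AE', of "max 0 (t - e)" "min T (t + e)"]) (use t e T in auto)
      then show "\<exists>y\<in>S. dist y t < e" by (intro bexI[of _ s]) (auto simp: S_def dist_real_def)
    qed
  qed
  moreover have "closure S \<subseteq> {0..T}" by (intro closure_minimal) (auto simp: S_def)
  ultimately have cl: "closure S = {0..T}" by (rule antisym[rotated])
  show ?thesis
  proof (rule continuous_le_on_closure[where f = g and S = S and x = t])
    show "continuous_on (closure S) g" "t \<in> closure S" using g t cl by simp_all
    show "g s \<le> c" if "s \<in> S" for s using that by (simp add: S_def)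
  qed
qed

text \<open>The first moment is a supremum of functions continuous in time, hence lower
  semicontinuous: an upper bound at almost every time passes to each cutoff and then to the
  supremum.\<close>

lemma M1_le_of_AE:
  assumes f: "\<And>t. t \<in> {0..T} \<Longrightarrow> f t \<in> radon_measures {0<..}"
    and xf: "(\<lambda>t. x_times (f t)) \<in> weak_star_curves T {0<..} (bounded_radon_measures {0<..})"
    and T: "0 < T" and c: "0 \<le> c"
    and AE: "AE t in lborel. t \<in> {0..T} \<longrightarrow> M1 (f t) \<le> ennreal c" and t: "t \<in> {0..T}"
  shows "M1 (f t) \<le> ennreal c"
proof -
  have nu: "x_times (f s) \<in> bounded_radon_measures {0<..}" if "s \<in> {0..T}" for s
    using xf that by (auto simp: weak_star_curves_def)
  have meas: "(\<integral>\<^sup>+x. indicator A x \<partial>x_times (f s)) = (\<integral>\<^sup>+x\<in>A. ennreal x \<partial>f s)"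
    if "s \<in> {0..T}" "A \<in> sets borel" for s A
    unfolding x_times_def using that
    by (intro nn_integral_density radon_measurable[OF f]) auto
  have "(\<integral>\<^sup>+x. indicator {0<..<v} x \<partial>x_times (f t)) \<le> ennreal c" for v
    unfolding emeasure_eq_SUP_bump[OF nu[OF t]]
  proof (intro SUP_least ennreal_leI)
    fix n
    define g where "g s = (\<integral>x. bump 0 v n x \<partial>x_times (f s))" for s
    have "continuous_on {0..T} g"
      unfolding g_def using xf bump_compactly_supported[of 0 v n] by (auto simp: weak_star_curves_def)
    moreover have "AE s in lborel. s \<in> {0..T} \<longrightarrow> g s \<le> c"
      using AE
    proof eventually_elim
      case (elim s)
      show ?case
      proof
        assume s: "s \<in> {0..T}"
        have "ennreal (g s) \<le> (\<integral>\<^sup>+x. indicator {0<..<v} x \<partial>x_times (f s))"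
          unfolding emeasure_eq_SUP_bump[OF nu[OF s]] g_def by (rule SUP_upper) simp
        also have "\<dots> \<le> M1 (f s)"
          using s unfolding M1_def by (subst meas) (auto intro!: nn_integral_mono split: split_indicator)
        also have "\<dots> \<le> ennreal c" using elim s by simp
        finally show "g s \<le> c" using c by (simp add: ennreal_le_iff)
      qed
    qed
    ultimately show "(\<integral>x. bump 0 v n x \<partial>x_times (f t)) \<le> c"
      using continuous_le_of_AE[OF _ T _ t] by (auto simp: g_def)
  qed
  \<comment> \<open>The cutoffs reach open intervals only, so the half-closed (0, n] is enlarged to
    (0, n + 1).\<close>
  moreover have "mass_upto (f t) (real n) \<le> (\<integral>\<^sup>+x. indicator {0<..<real n + 1} x \<partial>x_times (f t))" for n
    unfolding mass_upto_def using t by (subst meas) (auto intro!: nn_integral_mono split: split_indicator)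
  ultimately have "mass_upto (f t) (real n) \<le> ennreal c" for n
    by (rule order_trans[rotated])
  then show ?thesis
    unfolding SUP_mass_upto[OF f[OF t], symmetric] by (intro SUP_least)
qed

section \<open>Normalised mass measures as a measurable family\<close>

definition mass_measure :: "real \<Rightarrow> real measure \<Rightarrow> real measure" where
  "mass_measure c \<mu> = distr (density \<mu> (\<lambda>x. ennreal (x / c))) borel (\<lambda>x. x)"

lemma sets_mass_measure [simp, measurable_cong]: "sets (mass_measure c \<mu>) = sets borel"
  by (simp add: mass_measure_def)

text \<open>The push-forward under the identity only replaces the trace sigma-algebra by the full
  Borel one, as \<open>subprob_algebra borel\<close> demands; integrals see just the density
  x/c.\<close>

lemma nn_integral_mass_measure:
  assumes mu: "\<mu> \<in> radon_measures X" and g: "g \<in> borel_measurable borel"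
  shows "(\<integral>\<^sup>+x. g x \<partial>mass_measure c \<mu>) = (\<integral>\<^sup>+x. ennreal (x / c) * g x \<partial>\<mu>)"
proof -
  have "(\<lambda>x. x) \<in> borel_measurable (density \<mu> (\<lambda>x. ennreal (x / c)))"
    using radon_measurable[OF mu, of "\<lambda>x. x" borel] by simp
  then show ?thesis
    unfolding mass_measure_def using g
    by (subst nn_integral_distr) (auto intro!: nn_integral_density radon_measurable[OF mu])
qed

lemma emeasure_mass_measure:
  assumes mu: "\<mu> \<in> radon_measures {0<..}" and c: "0 < c" and A: "A \<in> sets borel"
  shows "emeasure (mass_measure c \<mu>) A = ennreal (1 / c) * (\<integral>\<^sup>+x\<in>A. ennreal x \<partial>\<mu>)"
proof -
  have "emeasure (mass_measure c \<mu>) A = (\<integral>\<^sup>+x. indicator A x \<partial>mass_measure c \<mu>)"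
    using A by simp
  also have "\<dots> = (\<integral>\<^sup>+x. ennreal (1 / c) * (ennreal x * indicator A x) \<partial>\<mu>)"
    using A c by (subst nn_integral_mass_measure[OF mu])
      (auto simp: radon_space[OF mu] ennreal_mult[symmetric] mult.assoc[symmetric] intro!: nn_integral_cong)
  also have "\<dots> = ennreal (1 / c) * (\<integral>\<^sup>+x\<in>A. ennreal x \<partial>\<mu>)"
    using A by (intro nn_integral_cmult radon_measurable[OF mu]) auto
  finally show ?thesis .
qed

lemma subprob_mass_measure:
  assumes mu: "\<mu> \<in> radon_measures {0<..}" and c: "0 < c" and le: "M1 \<mu> \<le> ennreal c"
  shows "subprob_space (mass_measure c \<mu>)"
proof (rule subprob_spaceI)
  have "emeasure (mass_measure c \<mu>) (space (mass_measure c \<mu>)) = ennreal (1 / c) * M1 \<mu>"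
    using emeasure_mass_measure[OF mu c, of UNIV] by (simp add: mass_measure_def M1_def)
  also have "\<dots> \<le> ennreal (1 / c) * ennreal c" using le by (intro mult_left_mono) auto
  also have "\<dots> = 1" using c by (simp add: ennreal_mult[symmetric])
  finally show "emeasure (mass_measure c \<mu>) (space (mass_measure c \<mu>)) \<le> 1" .
qed (simp add: mass_measure_def)

text \<open>Measurability in time is checked on the intersection-stable family of open intervals,
  where the measure is a countable supremum of functions continuous in time.\<close>

lemma mass_measure_kernel:
  assumes f: "\<And>s. s \<in> {0..T} \<Longrightarrow> f s \<in> radon_measures {0<..}"
    and xf: "(\<lambda>t. x_times (f t)) \<in> weak_star_curves T {0<..} (bounded_radon_measures {0<..})"
    and c: "0 < c" and le: "\<And>s. s \<in> {0..T} \<Longrightarrow> M1 (f s) \<le> ennreal c"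
    and t: "t \<le> T"
  shows "(\<lambda>s. mass_measure c (f s)) \<in> measurable (restrict_space lborel {0..t}) (subprob_algebra borel)"
proof (rule measurable_subprob_algebra_generated)
  let ?G = "range (\<lambda>(u, v). {u<..<v::real})"
  have sp: "space (restrict_space lborel {0..t}) = {0..t}" by (simp add: space_restrict_space)
  show "sets (borel :: real measure) = sigma_sets UNIV ?G"
    using arg_cong[OF borel_eq_box[where 'a = real], of sets] by simp
  show "Int_stable ?G"
  proof (rule Int_stableI, clarify)
    fix u v u' v' :: real
    have "{u<..<v} \<inter> {u'<..<v'} = {max u u'<..<min v v'}" by auto
    then show "{u<..<v} \<inter> {u'<..<v'} \<in> ?G" by (auto intro!: image_eqI[of _ _ "(max u u', min v v')"])
  qed
  have nu: "x_times (f s) \<in> bounded_radon_measures {0<..}" if "s \<in> {0..T}" for s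
    using xf that by (auto simp: weak_star_curves_def)
  have eq: "emeasure (mass_measure c (f s)) {u<..<v}
      = ennreal (1 / c) * (SUP n. ennreal (\<integral>x. bump (max 0 u) v n x \<partial>x_times (f s)))" if s: "s \<in> {0..t}" for s u v
  proof -
    have s': "s \<in> {0..T}" using s t by auto
    \<comment> \<open>The measure lives on the half-line, so the left end is raised to 0, where the
      cutoffs are admissible test functions.\<close>
    have "(\<integral>\<^sup>+x\<in>{u<..<v}. ennreal x \<partial>f s) = (\<integral>\<^sup>+x\<in>{max 0 u<..<v}. ennreal x \<partial>f s)"
      by (intro nn_integral_cong) (auto simp: radon_space[OF f[OF s']] split: split_indicator)
    also have "\<dots> = (\<integral>\<^sup>+x. indicator {max 0 u<..<v} x \<partial>x_times (f s))"
      unfolding x_times_def by (intro nn_integral_density[symmetric] radon_measurable[OF f[OF s']]) auto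
    finally show ?thesis
      using emeasure_mass_measure[OF f[OF s'] c, of "{u<..<v}"] by (simp add: emeasure_eq_SUP_bump[OF nu[OF s']])
  qed
  have interval: "(\<lambda>s. emeasure (mass_measure c (f s)) {u<..<v}) \<in> borel_measurable (restrict_space lborel {0..t})" for u v
  proof -
    have "(\<lambda>s. \<integral>x. bump (max 0 u) v n x \<partial>x_times (f s)) \<in> borel_measurable (restrict_space borel {0..t})" for n
    proof (rule borel_measurable_continuous_on_restrict, rule continuous_on_subset)
      show "continuous_on {0..T} (\<lambda>s. \<integral>x. bump (max 0 u) v n x \<partial>x_times (f s))"
        using xf bump_compactly_supported[of "max 0 u" v n] by (auto simp: weak_star_curves_def)
    qed (use t in auto)
    then have [measurable]: "(\<lambda>s. \<integral>x. bump (max 0 u) v n x \<partial>x_times (f s)) \<in> borel_measurable (restrict_space lborel {0..t})" for n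
      by (simp add: measurable_def space_restrict_space sets_restrict_space)
    have "(\<lambda>s. ennreal (1 / c) * (SUP n. ennreal (\<integral>x. bump (max 0 u) v n x \<partial>x_times (f s)))) \<in> borel_measurable (restrict_space lborel {0..t})"
      by measurable
    then show ?thesis
      by (rule measurable_cong[THEN iffD2, rotated]) (simp add: sp eq)
  qed
  then show "(\<lambda>s. emeasure (mass_measure c (f s)) A) \<in> borel_measurable (restrict_space lborel {0..t})"
    if "A \<in> ?G" for A using that by auto
  \<comment> \<open>The total mass needs its own argument: the whole line is no bounded interval but
    an increasing union of them.\<close>
  have UN: "(\<Union>n. {- real n<..<real n}) = UNIV"
  proof (intro set_eqI iffI UNIV_I)
    fix x :: real
    obtain n where "\<bar>x\<bar> < real n" using reals_Archimedean2 by blast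
    then show "x \<in> (\<Union>n. {- real n<..<real n})" by (auto intro!: exI[of _ n])
  qed
  have "emeasure (mass_measure c (f s)) UNIV = (SUP n. emeasure (mass_measure c (f s)) {- real n<..<real n})" for s
    by (subst SUP_emeasure_incseq) (auto simp: UN incseq_def)
  then show "(\<lambda>s. emeasure (mass_measure c (f s)) UNIV) \<in> borel_measurable (restrict_space lborel {0..t})"
    using interval by simp
  show "subprob_space (mass_measure c (f s))" if "s \<in> space (restrict_space lborel {0..t})" for s
    using that t sp by (intro subprob_mass_measure f c le) auto
qed auto

text \<open>With finite masses the left side of the identity is real, which rules out an infinite
  time flux; all terms can then be moved to the side where they are added.\<close>

lemma flux_identity_ennreal:
  assumes "flux_identity K f0 f t z" "M1 (f t) < \<infinity>" "M1 f0 < \<infinity>" "0 \<le> t"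
  shows "mass_upto (f t) z + time_flux K f t z = mass_upto f0 z + ennreal t"
proof -
  have "mass_upto (f t) z < \<infinity>" "mass_upto f0 z < \<infinity>"
    using assms mass_upto_le_M1 order.strict_trans1 by blast+
  then obtain m m0 where m: "mass_upto (f t) z = ennreal m" "0 \<le> m" "mass_upto f0 z = ennreal m0" "0 \<le> m0"
    by (cases "mass_upto (f t) z" rule: ennreal_cases; cases "mass_upto f0 z" rule: ennreal_cases) auto
  show ?thesis
  proof (cases "time_flux K f t z" rule: ennreal_cases)
    case (real r)
    then have "m + r = m0 + t"
      using assms(1) m by (simp add: flux_identity_def enn2ereal_ennreal)
    then show ?thesis using real m assms(4) by (simp add: ennreal_plus[symmetric] del: ennreal_plus)
  next
    case top
    then show ?thesis using assms(1) m by (simp add: flux_identity_def enn2ereal_ennreal)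
  qed
qed

section \<open>Weak flux solutions\<close>

text \<open>Only the data are fixed here, not the solution, so every constant defined in this locale
  is uniform over all solutions.\<close>

locale coagulation =
  fixes K :: "real \<Rightarrow> real \<Rightarrow> real" and \<gamma> l T c1 c2 :: real and f0 :: "real measure"
  assumes K_cont: "continuous_on ({0<..} \<times> {0<..}) (\<lambda>(x, y). K x y)"
    and c1_pos: "0 < c1" and c2_pos: "0 < c2"
    and K_bounds: "kernel_bounds K \<gamma> l c1 c2"
    and exponents: "\<bar>\<gamma> + 2 * l\<bar> < 1" "\<gamma> < 1"
    and T_pos: "0 < T"
    and f0_radon: "f0 \<in> radon_measures {0<..}"
    and f0_mass: "x_times f0 \<in> bounded_radon_measures {0<..}"
begin

section \<open>Normalising the masses and rewriting the flux\<close>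

definition M :: real where "M = enn2real (M1 f0) + T"

lemma M_pos: "0 < M"
  using T_pos by (simp add: M_def add_nonneg_pos)

lemma M1_f0_finite: "M1 f0 < \<infinity>"
  using f0_mass M1_eq_emeasure[OF f0_radon] by (simp add: bounded_radon_measures_def)

lemma M_eq: "ennreal M = M1 f0 + ennreal T"
  using M1_f0_finite T_pos by (simp add: M_def ennreal_plus)

text \<open>The flux density with respect to two copies of the measure \<open>x f / M\<close>.\<close>

definition W :: "real \<Rightarrow> real \<Rightarrow> real" where
  "W x y = (if 0 < x \<and> 0 < y then M\<^sup>2 * K x y / y else 0)"

text \<open>Continuity on the open quadrant together with the value 0 elsewhere gives a Borel
  function on the plane.\<close>

lemma W_measurable: "(\<lambda>(x, y). W x y) \<in> borel_measurable borel"
proof -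
  have "(\<lambda>p. indicator ({0<..} \<times> {0<..}) p *\<^sub>R (M\<^sup>2 * (case p of (x, y) \<Rightarrow> K x y) / snd p))
      \<in> borel_measurable borel"
    by (intro borel_measurable_continuous_on_indicator continuous_intros K_cont
      borel_open[OF open_Times[OF open_greaterThan open_greaterThan]]) auto
  also have "(\<lambda>p. indicator ({0<..} \<times> {0<..}) p *\<^sub>R (M\<^sup>2 * (case p of (x, y) \<Rightarrow> K x y) / snd p)) = (\<lambda>(x, y). W x y)"
    by (auto simp: W_def fun_eq_iff split: split_indicator)
  finally show ?thesis .
qed

lemma W_lower:
  assumes "0 < x" "0 < y"
  shows "M\<^sup>2 * c1 * (x powr (\<gamma> + l) * y powr (- l - 1)) \<le> W x y"
proof -
  have "c1 * (x powr (\<gamma> + l) * y powr - l) \<le> c1 * (x powr (\<gamma> + l) * y powr - l + x powr - l * y powr (\<gamma> + l))"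
    using c1_pos by (intro mult_left_mono) auto
  also have "\<dots> \<le> K x y" using K_bounds assms by (auto simp: kernel_bounds_def)
  finally have "M\<^sup>2 * (c1 * (x powr (\<gamma> + l) * y powr - l)) / y \<le> M\<^sup>2 * K x y / y"
    using assms by (intro divide_right_mono mult_left_mono) auto
  then show ?thesis
    using assms by (simp add: W_def powr_diff mult_ac)
qed

lemma W_upper:
  assumes "0 < x" "0 < y"
  shows "W x y \<le> M\<^sup>2 * c2 * (x powr (\<gamma> + l) * y powr (- l - 1) + x powr - l * y powr (\<gamma> + l - 1))"
proof -
  have "K x y \<le> c2 * (x powr (\<gamma> + l) * y powr - l + x powr - l * y powr (\<gamma> + l))"
    using K_bounds assms by (auto simp: kernel_bounds_def)
  then have "M\<^sup>2 * K x y / y \<le> M\<^sup>2 * (c2 * (x powr (\<gamma> + l) * y powr - l + x powr - l * y powr (\<gamma> + l))) / y"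
    using assms by (intro divide_right_mono mult_left_mono) auto
  then show ?thesis
    using assms by (simp add: W_def powr_diff algebra_simps add_divide_distrib)
qed

lemma Omega_indicator_measurable: "(\<lambda>(x, y). indicator (Omega z) (x, y) :: ennreal) \<in> borel_measurable (borel \<Otimes>\<^sub>M borel)"
proof -
  have "(\<lambda>(x, y). indicator (Omega z) (x, y) :: ennreal)
      = indicator {p. 0 < fst p \<and> 0 < snd p \<and> fst p \<le> z \<and> z - fst p < snd p}"
    by (auto simp: Omega_def fun_eq_iff split: split_indicator)
  then show ?thesis by simp
qed

text \<open>The densities x/M and y/M of the two mass measures cancel the factor M^2/y in
  \<open>W\<close> and leave x K(x,y).\<close>

lemma flux_eq_mass:
  assumes mu: "\<mu> \<in> radon_measures {0<..}" and le: "M1 \<mu> \<le> ennreal M"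
  shows "(\<integral>\<^sup>+x. \<integral>\<^sup>+y. ennreal (W x y) * indicator (Omega z) (x, y) \<partial>mass_measure M \<mu> \<partial>mass_measure M \<mu>) = flux K \<mu> z"
proof -
  let ?m = "mass_measure M \<mu>"
  define h where "h x y = ennreal (W x y) * indicator (Omega z) (x, y)" for x y
  interpret mu: sigma_finite_measure \<mu> using mu by (rule radon_sigma_finite)
  interpret m: subprob_space ?m using mu M_pos le by (rule subprob_mass_measure)
  have W2: "(\<lambda>p. W (fst p) (snd p)) \<in> borel_measurable (borel \<Otimes>\<^sub>M borel)"
    using W_measurable by (simp add: borel_prod split_beta')
  have h [measurable]: "(\<lambda>(x, y). h x y) \<in> borel_measurable (borel \<Otimes>\<^sub>M borel)"
    unfolding h_def using W2 Omega_indicator_measurable[of z] by (simp add: split_beta')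
  have h1 [measurable]: "h x \<in> borel_measurable borel" for x
    using measurable_compose[OF measurable_Pair1' h, of x] by simp
  have "(\<lambda>x. \<integral>\<^sup>+y. h x y \<partial>?m) \<in> borel_measurable borel"
    by (intro m.borel_measurable_nn_integral) (simp add: measurable_cong_sets[OF sets_pair_measure_cong[OF refl sets_mass_measure] refl])
  then have "(\<integral>\<^sup>+x. \<integral>\<^sup>+y. h x y \<partial>?m \<partial>?m) = (\<integral>\<^sup>+x. ennreal (x / M) * (\<integral>\<^sup>+y. ennreal (y / M) * h x y \<partial>\<mu>) \<partial>\<mu>)"
    by (subst nn_integral_mass_measure[OF mu]) (simp_all add: nn_integral_mass_measure[OF mu])
  also have "\<dots> = (\<integral>\<^sup>+x. (\<integral>\<^sup>+y. ennreal (x / M) * (ennreal (y / M) * h x y) \<partial>\<mu>) \<partial>\<mu>)"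
    by (intro nn_integral_cong nn_integral_cmult[symmetric] radon_measurable[OF mu]) measurable
  also have "\<dots> = (\<integral>\<^sup>+p. ennreal (fst p / M) * (ennreal (snd p / M) * h (fst p) (snd p)) \<partial>(\<mu> \<Otimes>\<^sub>M \<mu>))"
    using h by (subst mu.nn_integral_fst[symmetric]) (auto intro!: radon_pair_measurable[OF mu] simp: split_beta')
  also have "\<dots> = flux K \<mu> z"
    unfolding flux_def
  proof (rule nn_integral_cong)
    fix p assume "p \<in> space (\<mu> \<Otimes>\<^sub>M \<mu>)"
    then obtain x y where p: "p = (x, y)" "0 < x" "0 < y"
      by (auto simp: space_pair_measure radon_space[OF mu])
    have "ennreal (x / M) * (ennreal (y / M) * ennreal (W x y)) = ennreal (x / M * (y / M * W x y))"
    proof -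
      have "0 \<le> x / M" "0 \<le> y / M" using p M_pos by auto
      then show ?thesis by (simp only: ennreal_mult')
    qed
    also have "x / M * (y / M * W x y) = x * K x y"
      using p M_pos by (simp add: W_def power2_eq_square)
    finally show "ennreal (fst p / M) * (ennreal (snd p / M) * h (fst p) (snd p))
        = (case p of (x, y) \<Rightarrow> ennreal (x * K x y)) * indicator (Omega z) p"
      using p by (simp add: h_def mult.assoc[symmetric])
  qed
  finally show ?thesis by (simp add: h_def)
qed

text \<open>This is \<open>M * 2 powr \<bar>(1 + \<gamma>) / 2\<bar> * dyadic_const M\<close> with
  the length of the time interval replaced by T, written out so that neither t nor a solution
  enters.\<close>

definition moment_bound :: real where
  "moment_bound = M * 2 powr \<bar>(1 + \<gamma>) / 2\<bar> *
     (2 * 2 powr ((1 - \<gamma>) / 2) * (T + M / (M\<^sup>2 * c1 * 2 powr (- \<bar>\<gamma> + l\<bar> - \<bar>- l - 1\<bar>))))"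

section \<open>Consequences for a fixed solution\<close>

context
  fixes f
  assumes sol: "weak_flux_solution K T f0 f"
begin

lemma f_radon: "t \<in> {0..T} \<Longrightarrow> f t \<in> radon_measures {0<..}"
  using sol by (auto simp: weak_flux_solution_def weak_star_curves_def)

lemma xf_curve: "(\<lambda>t. x_times (f t)) \<in> weak_star_curves T {0<..} (bounded_radon_measures {0<..})"
  using sol by (simp add: weak_flux_solution_def)

lemma M1_f_finite: "t \<in> {0..T} \<Longrightarrow> M1 (f t) < \<infinity>"
  using xf_curve M1_eq_emeasure[OF f_radon] by (auto simp: weak_star_curves_def bounded_radon_measures_def)

lemma mass_balance:
  "t \<in> {0..T} \<Longrightarrow> flux_identity K f0 f t z \<Longrightarrow> mass_upto (f t) z + time_flux K f t z = mass_upto f0 z + ennreal t"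
  using flux_identity_ennreal M1_f_finite M1_f0_finite by auto

text \<open>Almost every time-section of a null set in the plane is null; the times obtained are the
  good times.\<close>

lemma AE_flux_identity: "AE t in lborel. t \<in> {0..T} \<longrightarrow> (AE z in lborel. z > 0 \<longrightarrow> flux_identity K f0 f t z)"
proof -
  have "AE p in lborel \<Otimes>\<^sub>M lborel. case p of (t, z) \<Rightarrow> t \<in> {0..T} \<and> z > 0 \<longrightarrow> flux_identity K f0 f t z"
    using sol unfolding lborel_prod by (simp add: weak_flux_solution_def)
  from lborel_pair.AE_pair[OF this] show ?thesis by eventually_elim auto
qed

lemma M1_le_of_identity:
  assumes t: "t \<in> {0..T}" and ident: "AE z in lborel. z > 0 \<longrightarrow> flux_identity K f0 f t z"
  shows "M1 (f t) \<le> ennreal M"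
  unfolding SUP_mass_upto[OF f_radon[OF t], symmetric]
proof (rule SUP_least)
  fix n
  obtain z where z: "real n < z" "flux_identity K f0 f t z"
    by (rule AE_positive_obtain[OF ident, of "real n" "real n + 1"]) auto
  have "mass_upto (f t) (real n) \<le> mass_upto (f t) z + time_flux K f t z"
    using mass_upto_mono[of "real n" z "f t"] z by (simp add: add_increasing2)
  also have "\<dots> = mass_upto f0 z + ennreal t" using t z by (intro mass_balance)
  also have "\<dots> \<le> M1 f0 + ennreal T" using t by (intro add_mono mass_upto_le_M1 ennreal_leI) auto
  finally show "mass_upto (f t) (real n) \<le> ennreal M" by (simp add: M_eq)
qed

text \<open>Semicontinuity carries the bound from good times to all times, so that dividing by M
  yields a sub-probability at every time.\<close>

lemma M1_le: "t \<in> {0..T} \<Longrightarrow> M1 (f t) \<le> ennreal M"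
proof (rule M1_le_of_AE[where T = T and f = f])
  show "AE t in lborel. t \<in> {0..T} \<longrightarrow> M1 (f t) \<le> ennreal M"
    using AE_flux_identity by eventually_elim (auto intro: M1_le_of_identity)
qed (use f_radon xf_curve T_pos M_pos in auto)

lemma mass_flux_instance:
  assumes t: "t \<in> {0..T}"
  shows "mass_flux (restrict_space lborel {0..t}) (\<lambda>s. mass_measure M (f s)) W (\<gamma> + l) (- l) (M\<^sup>2 * c1) (M\<^sup>2 * c2)"
proof (intro mass_flux.intro mass_flux_axioms.intro)
  show "finite_measure (restrict_space lborel {0..t})"
    using t by (intro finite_measureI) (simp add: space_restrict_space emeasure_restrict_space)
  show "(\<lambda>s. mass_measure M (f s)) \<in> measurable (restrict_space lborel {0..t}) (subprob_algebra borel)"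
    using f_radon xf_curve M_pos M1_le t by (intro mass_measure_kernel[where T = T]) auto
  show "\<bar>\<gamma> + l - - l\<bar> < 1" "\<gamma> + l + - l < 1" using exponents by (simp_all add: algebra_simps)
qed (use W_measurable W_lower W_upper M_pos c1_pos c2_pos in auto)

text \<open>The identity is assumed at the single time t. Earlier times enter only through the
  integrated flux and through \<open>M1_le\<close>, so the almost-everywhere and the everywhere
  assertions are both instances.\<close>

lemma at_good_time:
  assumes t: "t \<in> {0..T}" and ident: "AE z in lborel. z > 0 \<longrightarrow> flux_identity K f0 f t z"
  shows "M1 (f t) = M1 f0 + ennreal t"
    and "0 < z \<Longrightarrow> averaged_moment \<gamma> f t z \<le> ennreal moment_bound"
proof -
  let ?P = "restrict_space lborel {0..t}"
  interpret mass_flux ?P "\<lambda>s. mass_measure M (f s)" W "\<gamma> + l" "- l" "M\<^sup>2 * c1" "M\<^sup>2 * c2"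
    using t by (rule mass_flux_instance)
  have in_T: "s \<in> {0..T}" if "s \<in> {0..t}" for s using t that by auto
  have restrict: "(\<integral>\<^sup>+s. g s \<partial>?P) = (\<integral>\<^sup>+s\<in>{0..t}. g s \<partial>lborel)" for g
    by (rule nn_integral_restrict_space) simp
  have time_flux_eq: "(\<integral>\<^sup>+s. F s z \<partial>?P) = time_flux K f t z" for z
    unfolding restrict time_flux_def F_def
    by (intro nn_integral_cong) (auto split: split_indicator intro!: flux_eq_mass f_radon M1_le in_T)
  have \<delta>_eq: "\<delta> = (1 - \<gamma>) / 2" by (simp add: \<delta>_def)
  have good: "AE z in lborel. z > 0 \<longrightarrow> (\<integral>\<^sup>+s. F s z \<partial>?P) \<le> ennreal M"
    using ident
  proof eventually_elim
    case (elim z)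
    have "time_flux K f t z \<le> ennreal M" if "0 < z"
    proof -
      have "time_flux K f t z \<le> mass_upto (f t) z + time_flux K f t z" by (simp add: add_increasing)
      also have "\<dots> = mass_upto f0 z + ennreal t" using elim that t by (intro mass_balance) auto
      also have "\<dots> \<le> M1 f0 + ennreal T" using t by (intro add_mono mass_upto_le_M1 ennreal_leI) auto
      finally show ?thesis by (simp add: M_eq)
    qed
    then show ?case by (simp add: time_flux_eq)
  qed
  have dyadic: "(\<integral>\<^sup>+s. emeasure (mass_measure M (f s)) {z/2..z} \<partial>?P) \<le> ennreal (dyadic_const M * z powr \<delta>)"
    if "0 < z" for z
    using good M_pos that by (intro dyadic_mass) auto
  have dc: "0 \<le> dyadic_const M"
    using M_pos c1_pos by (simp add: dyadic_const_def)

  \<comment> \<open>The windows [R, 2R] with R = n + 1 have positive R from n = 0 on and drive z to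
    infinity, while the chosen flux values are O(R^(-\<delta>)).\<close>
  have "\<exists>z. \<forall>n. z n \<in> {real n + 1..2 * (real n + 1)} \<and> flux_identity K f0 f t (z n) \<and>
      time_flux K f t (z n) \<le> ennreal ((decay_const (dyadic_const M) + 1) * (real n + 1) powr - \<delta>)"
  proof (intro choice allI)
    fix n
    have "\<exists>z\<in>{real n + 1..2 * (real n + 1)}. flux_identity K f0 f t z \<and>
      (\<integral>\<^sup>+s. F s z \<partial>?P) \<le> ennreal ((decay_const (dyadic_const M) + 1) * (real n + 1) powr - \<delta>)"
      by (rule small_time_flux[OF dyadic dc _ ident]) auto
    then show "\<exists>z. z \<in> {real n + 1..2 * (real n + 1)} \<and> flux_identity K f0 f t z \<and>
      time_flux K f t z \<le> ennreal ((decay_const (dyadic_const M) + 1) * (real n + 1) powr - \<delta>)"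
      unfolding time_flux_eq by blast
  qed
  then obtain z where z: "\<And>n. real n + 1 \<le> z n" "\<And>n. flux_identity K f0 f t (z n)"
    "\<And>n. time_flux K f t (z n) \<le> ennreal ((decay_const (dyadic_const M) + 1) * (real n + 1) powr - \<delta>)"
    by auto
  have z': "real n \<le> z n" for n using z(1)[of n] by simp
  have "(\<lambda>n. (decay_const (dyadic_const M) + 1) * (real n + 1) powr - \<delta>) \<longlonglongrightarrow> (decay_const (dyadic_const M) + 1) * 0"
    using \<delta>_pos
    using filterlim_tendsto_add_at_top[OF tendsto_const filterlim_real_sequentially, of 1]
    by (intro tendsto_mult tendsto_const tendsto_neg_powr) (auto simp: add.commute)
  from tendsto_ennrealI[OF this]
  have lim: "(\<lambda>n. ennreal ((decay_const (dyadic_const M) + 1) * (real n + 1) powr - \<delta>)) \<longlonglongrightarrow> 0"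
    by simp
  have "(\<lambda>n. time_flux K f t (z n)) \<longlonglongrightarrow> 0"
    by (rule tendsto_sandwich[OF _ _ tendsto_const lim]) (intro always_eventually allI zero_le z(3))+
  \<comment> \<open>By the balance this sequence also equals the truncated initial mass plus t;
    comparing the two limits gives (A).\<close>
  then have "(\<lambda>n. mass_upto (f t) (z n) + time_flux K f t (z n)) \<longlonglongrightarrow> M1 (f t) + 0"
    by (intro tendsto_add mass_upto_tendsto f_radon t z')
  then have "(\<lambda>n. mass_upto f0 (z n) + ennreal t) \<longlonglongrightarrow> M1 (f t)"
    by (simp add: mass_balance[OF t z(2)])
  moreover have "(\<lambda>n. mass_upto f0 (z n) + ennreal t) \<longlonglongrightarrow> M1 f0 + ennreal t"
    by (intro tendsto_add mass_upto_tendsto f0_radon z' tendsto_const)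
  ultimately show "M1 (f t) = M1 f0 + ennreal t"
    by (rule LIMSEQ_unique)

  show "averaged_moment \<gamma> f t z \<le> ennreal moment_bound" if z: "0 < z" for z
  proof -
    \<comment> \<open>One factor x of the integrand is the mass density; the remaining power is
      comparable with z^((1 + \<gamma>)/2) = z^(1 - \<delta>). After division by z this leaves
      z^(-\<delta>), which cancels the z^\<delta> of the dyadic estimate.\<close>
    let ?k = "M * 2 powr \<bar>(1 + \<gamma>) / 2\<bar> * z powr - \<delta>"
    have pt: "ennreal (1 / z) * (\<integral>\<^sup>+x\<in>{z / 2..z}. ennreal (x powr ((3 + \<gamma>) / 2)) \<partial>f s)
        \<le> ennreal ?k * emeasure (mass_measure M (f s)) {z/2..z}" if s: "s \<in> {0..t}" for s
    proof -
      let ?q = "2 powr \<bar>(1 + \<gamma>) / 2\<bar> * z powr ((1 + \<gamma>) / 2)"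
      have "(\<integral>\<^sup>+x\<in>{z / 2..z}. ennreal (x powr ((3 + \<gamma>) / 2)) \<partial>f s) \<le> (\<integral>\<^sup>+x. ennreal ?q * (ennreal x * indicator {z/2..z} x) \<partial>f s)"
      proof (rule nn_integral_mono)
        fix x
        show "ennreal (x powr ((3 + \<gamma>) / 2)) * indicator {z / 2..z} x \<le> ennreal ?q * (ennreal x * indicator {z/2..z} x)"
        proof (cases "x \<in> {z/2..z}")
          case True
          then have x: "0 < x" using z by auto
          have "(3 + \<gamma>) / 2 = (1 + \<gamma>) / 2 + 1" by (simp add: field_simps)
          then have "x powr ((3 + \<gamma>) / 2) = x powr ((1 + \<gamma>) / 2) * x"
            using x by (simp only: powr_add) simp
          also have "\<dots> \<le> ?q * x"
            using True z x by (intro mult_right_mono powr_comparable) auto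
          finally show ?thesis using True x by (simp add: ennreal_mult[symmetric] ennreal_leI)
        qed simp
      qed
      also have "\<dots> = ennreal ?q * (\<integral>\<^sup>+x\<in>{z/2..z}. ennreal x \<partial>f s)"
        using f_radon[OF in_T[OF s]] by (intro nn_integral_cmult radon_measurable[of "f s" "{0<..}"]) auto
      finally have "ennreal (1 / z) * (\<integral>\<^sup>+x\<in>{z / 2..z}. ennreal (x powr ((3 + \<gamma>) / 2)) \<partial>f s)
          \<le> ennreal (1 / z) * (ennreal ?q * (\<integral>\<^sup>+x\<in>{z/2..z}. ennreal x \<partial>f s))"
        by (rule mult_left_mono) simp
      also have "\<dots> = ennreal (1 / z * ?q) * (\<integral>\<^sup>+x\<in>{z/2..z}. ennreal x \<partial>f s)"
      proof -
        have "ennreal (1 / z * ?q) = ennreal (1 / z) * ennreal ?q" using z by (intro ennreal_mult) auto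
        then show ?thesis by (simp only: mult.assoc)
      qed
      also have "1 / z * ?q = ?k * (1 / M)"
      proof -
        have "z powr ((1 + \<gamma>) / 2) = z powr (1 - \<delta>)"
          by (rule arg_cong[where f = "\<lambda>e. z powr e"]) (simp add: \<delta>_eq field_simps)
        then show ?thesis
          using z M_pos by (simp add: powr_diff powr_minus field_simps)
      qed
      also have "ennreal (?k * (1 / M)) = ennreal ?k * ennreal (1 / M)"
        using M_pos by (intro ennreal_mult) auto
      also have "ennreal ?k * ennreal (1 / M) * (\<integral>\<^sup>+x\<in>{z/2..z}. ennreal x \<partial>f s) = ennreal ?k * emeasure (mass_measure M (f s)) {z/2..z}"
        using f_radon[OF in_T[OF s]] M_pos by (subst emeasure_mass_measure) (auto simp: mult.assoc)
      finally show ?thesis .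
    qed
    have "averaged_moment \<gamma> f t z \<le> (\<integral>\<^sup>+s. ennreal ?k * emeasure (mass_measure M (f s)) {z/2..z} \<partial>?P)"
      unfolding averaged_moment_def restrict[symmetric]
      by (intro nn_integral_mono pt) (simp add: space_restrict_space)
    also have "\<dots> = ennreal ?k * (\<integral>\<^sup>+s. emeasure (mass_measure M (f s)) {z/2..z} \<partial>?P)"
      using N_measurable by (intro nn_integral_cmult) auto
    also have "\<dots> \<le> ennreal ?k * ennreal (dyadic_const M * z powr \<delta>)"
      using z by (intro mult_left_mono dyadic) auto
    also have "\<dots> = ennreal (M * 2 powr \<bar>(1 + \<gamma>) / 2\<bar> * dyadic_const M)"
      using z M_pos dc by (subst ennreal_mult[symmetric]) (auto simp: powr_minus)
    \<comment> \<open>The time interval has measure t \<le> T, which makes the constant uniform in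
      t.\<close>
    also have "dyadic_const M \<le> 2 * 2 powr ((1 - \<gamma>) / 2) * (T + M / (M\<^sup>2 * c1 * 2 powr (- \<bar>\<gamma> + l\<bar> - \<bar>- l - 1\<bar>)))"
      using t unfolding dyadic_const_def \<delta>_eq
      by (intro mult_left_mono add_right_mono) (auto simp: measure_restrict_space)
    then have "ennreal (M * 2 powr \<bar>(1 + \<gamma>) / 2\<bar> * dyadic_const M) \<le> ennreal moment_bound"
      using M_pos unfolding moment_bound_def by (intro ennreal_leI mult_left_mono) auto
    finally show ?thesis .
  qed
qed

end
end

text \<open>A null set of times multiplied by the whole line is null in the plane, since 0 times
  infinity is 0.\<close>

lemma AE_lborel_fst:
  assumes "AE t in lborel. Q t"
  shows "AE (t, z) in (lborel :: (real \<times> real) measure). Q t"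
proof -
  obtain B where B: "{t \<in> space lborel. \<not> Q t} \<subseteq> B" "emeasure lborel B = 0" "B \<in> sets lborel"
    using assms by (rule AE_E)
  show ?thesis
  proof (rule AE_I)
    show "{p \<in> space lborel. \<not> (case p of (t, z) \<Rightarrow> Q t)} \<subseteq> B \<times> UNIV" using B(1) by auto
    show "emeasure (lborel :: (real \<times> real) measure) (B \<times> UNIV) = 0"
      unfolding lborel_prod[symmetric] using B by (subst lborel.emeasure_pair_measure_Times) auto
    show "B \<times> UNIV \<in> sets (lborel :: (real \<times> real) measure)"
      unfolding lborel_prod[symmetric] using B by (intro pair_measureI) auto
  qed
qed

section \<open>Assembling the assertions from the result at good times\<close>

theorem theorem2p2:
  fixes K :: "real \<Rightarrow> real \<Rightarrow> real" and \<gamma> l T :: real and f0 :: "real measure"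
  assumes K_cont: "continuous_on ({0<..} \<times> {0<..}) (\<lambda>(x, y). K x y)"
    and K_nonneg: "\<And>x y. x > 0 \<Longrightarrow> y > 0 \<Longrightarrow> K x y \<ge> 0"
    and K_bounds: "\<exists>c1 c2. 0 < c1 \<and> c1 \<le> c2 \<and> kernel_bounds K \<gamma> l c1 c2"
    and exponents: "\<bar>\<gamma> + 2 * l\<bar> < 1" "\<gamma> < 1"
    and T_pos: "T > 0"
    and f0_radon: "f0 \<in> radon_measures {0<..}"
    and f0_mass: "x_times f0 \<in> bounded_radon_measures {0<..}"
  shows "\<exists>C::real. \<forall>f. weak_flux_solution K T f0 f \<longrightarrow>
    (AE t in lborel. t \<in> {0..T} \<longrightarrow> M1 (f t) = M1 f0 + ennreal t) \<and>
    (AE (t, z) in lborel. t \<in> {0..T} \<and> z > 0 \<longrightarrow> averaged_moment \<gamma> f t z \<le> ennreal C) \<and>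
    ((\<forall>t\<in>{0..T}. AE z in lborel. z > 0 \<longrightarrow> flux_identity K f0 f t z) \<longrightarrow>
       (\<forall>t\<in>{0..T}. M1 (f t) = M1 f0 + ennreal t)) \<and>
    ((\<forall>t\<in>{0..T}. \<forall>z>0. flux_identity K f0 f t z) \<longrightarrow>
       (\<forall>t\<in>{0..T}. \<forall>z>0. averaged_moment \<gamma> f t z \<le> ennreal C))"
proof -
  obtain c1 c2 where c: "0 < c1" "c1 \<le> c2" "kernel_bounds K \<gamma> l c1 c2"
    using K_bounds by auto
  interpret coagulation K \<gamma> l T c1 c2 f0
    using c by unfold_locales (use assms in auto)
  show ?thesis
  proof (intro exI[of _ moment_bound] allI impI)
    fix f assume sol: "weak_flux_solution K T f0 f"
    note ident = AE_flux_identity[OF sol] and result = at_good_time[OF sol]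
    have 1: "AE t in lborel. t \<in> {0..T} \<longrightarrow> M1 (f t) = M1 f0 + ennreal t"
      using ident by eventually_elim (auto intro: result(1))
    \<comment> \<open>At a good time (B) holds for every z, so the exceptional set in the plane
      involves times only.\<close>
    have "AE t in lborel. t \<in> {0..T} \<longrightarrow> (\<forall>z>0. averaged_moment \<gamma> f t z \<le> ennreal moment_bound)"
      using ident by eventually_elim (auto intro: result(2))
    from AE_lborel_fst[OF this]
    have 2: "AE (t, z) in lborel. t \<in> {0..T} \<and> z > 0 \<longrightarrow> averaged_moment \<gamma> f t z \<le> ennreal moment_bound"
      by eventually_elim auto
    show "(AE t in lborel. t \<in> {0..T} \<longrightarrow> M1 (f t) = M1 f0 + ennreal t) \<and>
      (AE (t, z) in lborel. t \<in> {0..T} \<and> z > 0 \<longrightarrow> averaged_moment \<gamma> f t z \<le> ennreal moment_bound) \<and>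
      ((\<forall>t\<in>{0..T}. AE z in lborel. z > 0 \<longrightarrow> flux_identity K f0 f t z) \<longrightarrow>
         (\<forall>t\<in>{0..T}. M1 (f t) = M1 f0 + ennreal t)) \<and>
      ((\<forall>t\<in>{0..T}. \<forall>z>0. flux_identity K f0 f t z) \<longrightarrow>
         (\<forall>t\<in>{0..T}. \<forall>z>0. averaged_moment \<gamma> f t z \<le> ennreal moment_bound))"
      using 1 2 result by auto
  qed
qed

end
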